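(* Let $q=2^m$ with $m\ge 3$ and $n=q+1$. Let $h$ be an integer with $0\le h\le q$, $h\notin\{0,q/2,q\}$ and $\gcd(2h+1,n)=1$. Then the BCH code $\mathcal C_{(q,q+1,3,h)}$ is MDS if and only if there exists an integer $e$ with $\gcd(e,m)=1$ such that $2h+1\equiv\pm 2^e\pmod n$.
   Context: Fix a primitive $n$th root of unity $\beta\in\mathbb{F}_{q^2}^\times$ (with $n=q+1$). For $s\in\mathbb{Z}$ let $g_s(x)\in\mathbb{F}_q[x]$ be the minimal polynomial of $\beta^s$ over $\mathbb{F}_q$. The BCH code $\mathcal C_{(q,q+1,3,h)}$ is the cyclic code of length $n$ over $\mathbb{F}_q$ generated by $g(x)=\mathrm{lcm}(g_h(x),g_{h+1}(x))$ in $\mathbb{F}_q[x]/(x^n-1)$. A linear $[N,k,d]$ code is MDS if $d=N-k+1$. *)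

theory Defs
  imports
    "HOL-Library.Cardinality"
    "HOL-Computational_Algebra.Computational_Algebra"
    "HOL-Number_Theory.Modular_Inverse"
    "Jordan_Normal_Form.Ring_Hom_Matrix"
begin

definition primitive_root_of_unity :: "nat \<Rightarrow> 'a::field \<Rightarrow> bool" where
  "primitive_root_of_unity n x \<longleftrightarrow>
     n > 0 \<and> x ^ n = 1 \<and> (\<forall>k. 0 < k \<and> k < n \<longrightarrow> x ^ k \<noteq> 1)"

text \<open>A field extension is given by a field homomorphism \<^term>\<open>emb\<close> from the small field
  into the large one.\<close>

definition min_poly :: "('a::field \<Rightarrow> 'b::field) \<Rightarrow> 'b \<Rightarrow> 'a poly" where
  "min_poly emb x =
     (THE p. lead_coeff p = 1 \<and> poly (map_poly emb p) x = 0 \<and>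
        (\<forall>r. r \<noteq> 0 \<and> poly (map_poly emb r) x = 0 \<longrightarrow> degree p \<le> degree r))"

text \<open>A word \<open>(c\<^sub>0, \<dots>, c\<^sub>N\<^sub>-\<^sub>1)\<close> of length \<open>N\<close> over \<open>'a\<close> is represented by the polynomial
  \<open>c\<^sub>0 + c\<^sub>1 x + \<dots> + c\<^sub>N\<^sub>-\<^sub>1 x\<^sup>N\<^sup>-\<^sup>1\<close>, and a residue class modulo \<open>x\<^sup>N - 1\<close> by its representative of
  degree less than \<open>N\<close>.\<close>

definition words :: "nat \<Rightarrow> 'a::field poly set" where
  "words N = {c. \<forall>i\<ge>N. poly.coeff c i = 0}"

definition hamming_dist :: "nat \<Rightarrow> 'a::field poly \<Rightarrow> 'a poly \<Rightarrow> nat" where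
  "hamming_dist N c c' = card {i. i < N \<and> poly.coeff c i \<noteq> poly.coeff c' i}"

definition linear_code :: "nat \<Rightarrow> nat \<Rightarrow> nat \<Rightarrow> 'a::field poly set \<Rightarrow> bool" where
  "linear_code N k d C \<longleftrightarrow>
     C \<subseteq> words N \<and> Modules.module.subspace Polynomial.smult C \<and>
     Vector_Spaces.vector_space.dim Polynomial.smult C = k \<and>
     (\<exists>c\<in>C. \<exists>c'\<in>C. c \<noteq> c' \<and> hamming_dist N c c' = d) \<and>
     (\<forall>c\<in>C. \<forall>c'\<in>C. c \<noteq> c' \<longrightarrow> d \<le> hamming_dist N c c')"

definition MDS_code :: "nat \<Rightarrow> 'a::field poly set \<Rightarrow> bool" where
  "MDS_code N C \<longleftrightarrow> (\<exists>k d. linear_code N k d C \<and> int d = int N - int k + 1)"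

definition cyclic_code :: "nat \<Rightarrow> 'a::field poly \<Rightarrow> 'a poly set" where
  "cyclic_code n g = {(a * g) mod (Polynomial.monom 1 n - 1) |a. True}"

text \<open>The class \<^class>\<open>field_gcd\<close> only provides the (monic) \<^const>\<open>lcm\<close> on polynomials; it does
  not restrict the field, as every nonzero element of a field is a unit.\<close>

definition BCH_code_3 :: "('a::field_gcd \<Rightarrow> 'b::field) \<Rightarrow> 'b \<Rightarrow> nat \<Rightarrow> int \<Rightarrow> 'a poly set" where
  "BCH_code_3 emb \<beta> n h =
     cyclic_code n (lcm (min_poly emb (\<beta> powi h)) (min_poly emb (\<beta> powi (h + 1))))"

text \<open>A power with integer exponent of a number \<open>a\<close> coprime to \<open>n\<close>, modulo \<open>n\<close>.\<close>

definition powi_mod :: "int \<Rightarrow> int \<Rightarrow> int \<Rightarrow> int" where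
  "powi_mod n a e = (if e \<ge> 0 then a ^ nat e else modular_inverse n a ^ nat (- e))"

end

theory Submission
  imports Defs "HOL-Number_Theory.Residues" "Jordan_Normal_Form.Char_Poly"
begin

text \<open>
  Let \<open>U\<close> be the group of \<open>n\<close>-th roots of unity and \<open>k = 2h + 1\<close>. The code has dimension \<open>n - 4\<close>, so it
  is MDS iff it has no nonzero word of weight at most 4. Such a word exists iff the vectors
  \<open>(1, x, x\<^sup>k, x\<^sup>k\<^sup>+\<^sup>1)\<close> of some four points \<open>x\<close> of \<open>U\<close> are dependent, that is, iff \<open>x \<mapsto> x\<^sup>k\<close> preserves the
  cross ratio of four points of \<open>U\<close>.

  Cross ratios of points of \<open>U\<close> lie in the field of \<open>q\<close> elements, and for \<open>k = \<plusminus>2\<^sup>e\<close> the map raises them to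
  the power \<open>2\<^sup>e\<close>. This has no fixed points other than 0 and 1 when \<open>e\<close> is coprime to \<open>m\<close>.

  Conversely, let \<open>K\<close> be the even representative of \<open>\<plusminus>k\<close> below \<open>n\<close>. In the coordinate \<open>t = 1 / (x + 1)\<close>
  the MDS property says that the slopes of the chords through a fixed point of the graph of \<open>x \<mapsto> x\<^sup>K\<close> are
  distinct. They then run through all nonzero elements of the small field, so their sum vanishes.
  Writing \<open>1 / (y + 1) = y + y\<^sup>3 + \<dots> + y\<^sup>n\<^sup>-\<^sup>2\<close> on \<open>U - {1}\<close> and comparing Fourier coefficients, this becomes
  the statement that, with \<open>M\<close> the inverse of \<open>K\<close> modulo \<open>n\<close>, the residues \<open>M l mod n\<close> for \<open>1 \<le> l < K\<close> all have the
  same parity. Hence \<open>K\<close> times one of \<open>M\<close>, \<open>n - M\<close> equals \<open>n - 1 = 2\<^sup>m\<close>, and \<open>K\<close> is a power \<open>2\<^sup>e\<close>. Now the slopes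
  are the powers \<open>a ^ (2\<^sup>e - 1)\<close>, which are distinct only if \<open>e\<close> is coprime to \<open>m\<close>.
\<close>

section \<open>Preliminaries on finite fields and roots of unity\<close>

text \<open>Multiplication by a nonzero \<open>x\<close> permutes the nonzero elements; cancelling
  their product leaves \<open>x ^ (CARD('a) - 1) = 1\<close>.\<close>

lemma finite_field_power_card:
  fixes x :: "'a::{field,finite}"
  shows "x ^ CARD('a) = x"
proof (cases "x = 0")
  case False
  have "(\<Prod>y\<in>UNIV-{0}. x * y) = (\<Prod>y\<in>UNIV-{0}. y)"
    by (rule prod.reindex_bij_witness[of _ "\<lambda>y. y / x" "\<lambda>y. x * y"]) (use False in auto)
  then have "x ^ (CARD('a) - 1) = 1"
    by (simp add: prod.distrib)
  then show ?thesis
    by (metis mult.left_neutral power_minus_mult zero_less_card_finite)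
qed simp

section \<open>Powers of two and parities of residues modulo \<open>2 ^ m + 1\<close>\<close>

lemma two_power_minus_one_dvd:
  fixes d e :: nat
  assumes "d dvd e"
  shows "(2::nat) ^ d - 1 dvd 2 ^ e - 1"
proof -
  obtain k where "e = d * k" using assms by blast
  have "[(2 ^ d - 1) + 1 = 0 + 1] (mod (2::nat) ^ d - 1)"
    by (intro cong_add) (auto simp: cong_def)
  then have "[2 ^ d = 1] (mod (2::nat) ^ d - 1)" by simp
  from cong_pow[OF this, of k] have "[2 ^ e = 1] (mod (2::nat) ^ d - 1)"
    using \<open>e = d * k\<close> by (simp add: power_mult)
  then show ?thesis by (rule cong_to_1_nat)
qed

text \<open>Let \<open>J\<close> be the even one of \<open>M\<close> and \<open>n - M\<close>. As
  \<open>n\<close> is odd, the first multiple of \<open>J\<close> to pass \<open>n\<close> would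
  leave an odd residue, so none passes before the \<open>K\<close>-th. Thus
  \<open>K * J < 2 * n\<close>, and the only multiple of 4 there that is 1 or -1 modulo
  \<open>n\<close> is \<open>n - 1\<close>.\<close>

lemma residue_parity_imp_power_of_two:
  fixes m n K M :: nat
  assumes n: "n = 2 ^ m + 1" and m: "m \<ge> 2" and K: "even K" "K \<ge> 2" "K < n"
    and KM: "[K * M = 1] (mod n)" "M < n"
    and parity: "\<And>l. 2 \<le> l \<Longrightarrow> l < K \<Longrightarrow> even (M * l mod n) \<longleftrightarrow> even (M * (l - 1) mod n)"
  shows "\<exists>e. K = 2 ^ e"
proof -
  have "odd n" using n m by simp
  have n4: "n mod 4 = 1"
  proof -
    obtain k where "m = 2 + k" using m le_Suc_ex by blast
    then show ?thesis using n by (simp add: power_add)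
  qed
  have M_parity: "even (M * l mod n) \<longleftrightarrow> even M" if "1 \<le> l" "l < K" for l
    using that
  proof (induction l rule: nat_induct_at_least)
    case base
    then show ?case using KM(2) by simp
  next
    case (Suc l)
    then show ?case using parity[of "Suc l"] by simp
  qed
  define J where "J = (if even M then M else n - M)"
  have "even J" "J < n" using \<open>odd n\<close> KM(2) by (auto simp: J_def dest: odd_pos)
  have J_even: "even (J * l mod n)" if l: "1 \<le> l" "l < K" for l
  proof (cases "even M")
    case True
    then show ?thesis using M_parity[OF l] by (simp add: J_def)
  next
    case False
    have "J * l + M * l = n * l" using False KM(2) by (simp add: J_def diff_mult_distrib)
    then have "(J * l mod n + M * l mod n) mod n = 0" by (simp add: mod_add_eq)
    then obtain i where i: "J * l mod n + M * l mod n = n * i" by (auto simp: mod_eq_0_iff_dvd)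
    have odd: "odd (M * l mod n)" using M_parity[OF l] False by simp
    have "J * l mod n < n" "M * l mod n < n" using n by auto
    \<comment> \<open>The two residues add up to a positive multiple of \<open>n\<close> below
      \<open>2 * n\<close>, that is, to the odd number \<open>n\<close>, so exactly one of them is
      even.\<close>
    then have "n * i < n * 2" "n * i > 0" using i odd_pos[OF odd] by linarith+
    then have "i = 1" by simp
    then have "J * l mod n + M * l mod n = n" using i by simp
    then show ?thesis using odd \<open>odd n\<close> by (metis odd_add)
  qed
  have J_small: "J * l < n" if "l < K" for l
    using that
  proof (induction l)
    case (Suc l)
    show ?case
    proof (rule ccontr)
      assume "\<not> J * Suc l < n"
      moreover have "J * Suc l < 2 * n" using Suc \<open>J < n\<close> by simp
      ultimately have "J * Suc l mod n = J * Suc l - n"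
        by (simp add: le_mod_geq)
      moreover have "odd (J * Suc l - n)" using \<open>even J\<close> \<open>odd n\<close> \<open>\<not> J * Suc l < n\<close> by simp
      ultimately show False using J_even[of "Suc l"] Suc by simp
    qed
  qed (use n in simp)
  have "K * J < 2 * n"
  proof -
    have "K * J = J * (K - 1) + J" using K(2) by (simp add: algebra_simps flip: mult_Suc)
    then show ?thesis using J_small[of "K - 1"] K(2) \<open>J < n\<close> by simp
  qed
  have even_KJ: "even (K * J)" and four_KJ: "4 dvd K * J"
    using K(1) \<open>even J\<close> by (auto elim!: evenE)
  have "K * J = n - 1"
  proof (cases "even M")
    case True
    then have "K * J mod n = 1" using KM(1) n by (simp add: J_def cong_def)
    moreover have "K * J = n * (K * J div n) + K * J mod n" by simp
    moreover have "K * J div n < 2" using \<open>K * J < 2 * n\<close> by (simp add: less_mult_imp_div_less)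
    ultimately have "K * J = 1 \<or> K * J = n + 1" by (auto simp: less_2_cases_iff)
    \<comment> \<open>Neither 1 nor \<open>n + 1\<close>, which is 2 modulo 4, is divisible by 4, so
      this case is void.\<close>
    then show ?thesis using four_KJ n4 even_KJ by presburger
  next
    case False
    have "K * J + K * M = n * K"
      using False KM(2) by (simp add: J_def flip: distrib_left)
    then have "[K * J + K * M = 0] (mod n)" by (simp add: cong_def)
    moreover have "[K * J + K * M = K * J + 1] (mod n)" by (intro cong_add cong_refl KM(1))
    ultimately have "n dvd K * J + 1" by (metis cong_0_iff cong_sym cong_trans)
    then obtain i where i: "K * J + 1 = n * i" by blast
    then have "n * i < n * 3" using \<open>K * J < 2 * n\<close> n by simp
    then have "i < 3" by simp
    moreover have "odd i" using i even_KJ by (metis even_mult_iff even_plus_one_iff)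
    ultimately have "i = 1" by presburger
    then show ?thesis using i by simp
  qed
  then have "K dvd 2 ^ m" using n by (metis add_diff_cancel_right' dvd_triv_left)
  then show ?thesis using divides_primepow_nat[OF two_is_prime_nat] by auto
qed

section \<open>The extension of degree two, its subfield \<open>Fq\<close> and the group
  \<open>U\<close>\<close>

locale norm_one_group =
  fixes m q n :: nat
    and emb :: "'a::{field_gcd,finite} \<Rightarrow> 'b::{field,finite}" and \<beta> :: 'b
  assumes m_ge: "m \<ge> 3" and q_eq: "q = 2 ^ m" and n_eq: "n = q + 1"
    and card_a: "CARD('a) = q" and card_b: "CARD('b) = q ^ 2" and emb_hom: "field_hom emb"
    and prim: "primitive_root_of_unity n \<beta>"
begin

sublocale emb: field_hom emb by (rule emb_hom)

text \<open>The image of \<open>emb\<close>, described inside \<open>'b\<close> as a fixed set, so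
  that membership is checked by computing a power.\<close>

definition Fq :: "'b set" where "Fq = {x. x ^ q = x}"

text \<open>The kernel of the norm from \<open>'b\<close> to \<open>Fq\<close>, which sends
  \<open>x\<close> to \<open>x * x ^ q\<close>.\<close>

definition U :: "'b set" where "U = {x. x ^ n = 1}"

lemma q_ge: "q \<ge> 8"
  using power_increasing[OF m_ge, of "2::nat"] by (simp add: q_eq)

lemma even_q: "even q" and odd_n: "odd n" and n_ge: "n \<ge> 9"
  using q_ge m_ge by (auto simp: n_eq q_eq)

lemma CHAR_b: "CHAR('b) = 2"
proof -
  have "CHAR('b) > 0" by (simp add: finite_imp_CHAR_pos)
  then have pr: "prime CHAR('b)" by (rule prime_CHAR_semidom)
  have "CHAR('b) dvd 2 ^ (m * 2)"
    using CHAR_dvd_CARD[where 'a='b] by (simp add: card_b q_eq power_mult)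
  then have "CHAR('b) dvd 2" using pr prime_dvd_power by blast
  then show ?thesis using pr primes_dvd_imp_eq two_is_prime_nat by blast
qed

lemma two_eq_0 [simp]: "(2::'b) = 0"
proof -
  have "(of_nat 2 :: 'b) = 0" by (simp only: of_nat_eq_0_iff_char_dvd CHAR_b dvd_refl)
  then show ?thesis by simp
qed

lemma add_self [simp]: "(x::'b) + x = 0"
  using mult_2[of x] by simp

text \<open>In characteristic two every sign can be erased, and the simplifier does so here and in
  \<open>diff_b\<close>; \<open>add_eq_0_b\<close> turns a vanishing sum back into an
  equality.\<close>

lemma minus_b [simp]: "- (x::'b) = x"
  using add_self[of x] minus_unique by blast

lemma diff_b [simp]: "(x::'b) - y = x + y"
  using diff_conv_add_uminus[of x y] by simp

lemma add_cancel_b [simp]: "(x::'b) + (x + y) = y" "x + (y + x) = y"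
  by (metis add.assoc add.commute add_0 add_self)+

lemma add_eq_0_b: "(x::'b) + y = 0 \<longleftrightarrow> x = y"
  by (metis add_cancel_b(1) add_self add_0_right)

lemma frobenius: "((x::'b) + y) ^ 2 ^ e = x ^ 2 ^ e + y ^ 2 ^ e"
  by (rule freshmans_dream') (simp_all add: CHAR_b)

lemma of_nat_b: "(of_nat k :: 'b) = (if odd k then 1 else 0)"
  by (cases "even k") (auto elim!: evenE oddE)

lemma pow_q_add: "((x::'b) + y) ^ q = x ^ q + y ^ q"
  unfolding q_eq by (rule frobenius)

lemma Fq_closed:
  shows Fq_0: "0 \<in> Fq"
    and Fq_add: "x \<in> Fq \<Longrightarrow> y \<in> Fq \<Longrightarrow> x + y \<in> Fq"
    and Fq_mult: "x \<in> Fq \<Longrightarrow> y \<in> Fq \<Longrightarrow> x * y \<in> Fq"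
    and Fq_divide: "x \<in> Fq \<Longrightarrow> y \<in> Fq \<Longrightarrow> x / y \<in> Fq"
    and Fq_power: "x \<in> Fq \<Longrightarrow> x ^ k \<in> Fq"
proof -
  show 1: "0 \<in> Fq" "x \<in> Fq \<Longrightarrow> y \<in> Fq \<Longrightarrow> x + y \<in> Fq"
    "x \<in> Fq \<Longrightarrow> y \<in> Fq \<Longrightarrow> x * y \<in> Fq"
    "x \<in> Fq \<Longrightarrow> y \<in> Fq \<Longrightarrow> x / y \<in> Fq" for x y
    using q_ge by (simp_all add: Fq_def pow_q_add power_mult_distrib power_divide zero_power)
  show "x \<in> Fq \<Longrightarrow> x ^ k \<in> Fq"
    by (induction k) (auto simp: 1, simp add: Fq_def)
qed

text \<open>The image of \<open>emb\<close> has \<open>q\<close> elements and lies in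
  \<open>Fq\<close>, whose elements are roots of a polynomial of degree \<open>q\<close>; counting
  forces equality.\<close>

lemma range_emb: "range emb = Fq" and card_Fq: "card Fq = q"
proof -
  have sub: "range emb \<subseteq> Fq"
    using finite_field_power_card[where 'a='a]
    by (auto simp: Fq_def card_a simp flip: emb.hom_power)
  have card_range: "card (range emb) = q"
    by (simp add: card_image emb.inj_f card_a)
  let ?p = "Polynomial.monom 1 q - Polynomial.monom 1 1 :: 'b poly"
  have "poly.coeff ?p q = 1" using q_ge by simp
  then have p0: "?p \<noteq> 0" by (metis coeff_0 zero_neq_one)
  have "degree ?p \<le> q" using q_ge by (intro degree_diff_le) (auto simp: degree_monom_eq)
  moreover have "Fq = {x. poly ?p x = 0}" by (auto simp: Fq_def poly_monom add_eq_0_b)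
  ultimately have "card Fq \<le> q"
    using card_poly_roots_bound[OF p0] by simp
  then show "range emb = Fq" using sub card_range by (intro card_seteq) auto
  then show "card Fq = q" using card_range by simp
qed

text \<open>The norm \<open>x * x ^ q\<close> is 1. Conjugation thus acts on \<open>U\<close> as
  inversion, which later places traces and cross ratios in \<open>Fq\<close>.\<close>

lemma U_pow_q: "x \<in> U \<Longrightarrow> x ^ q = inverse x"
proof -
  assume "x \<in> U"
  then have "x ^ n = 1" by (simp add: U_def)
  then have "x * x ^ q = 1" by (simp add: n_eq)
  then show ?thesis using inverse_unique by metis
qed

lemma U_nonzero: "x \<in> U \<Longrightarrow> x \<noteq> 0"
  using n_ge by (auto simp: U_def zero_power)

lemma U_closed:
  shows U_1: "1 \<in> U"
    and U_mult: "x \<in> U \<Longrightarrow> y \<in> U \<Longrightarrow> x * y \<in> U"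
    and U_inverse: "x \<in> U \<Longrightarrow> inverse x \<in> U"
    and U_power: "x \<in> U \<Longrightarrow> x ^ k \<in> U"
    and U_powi: "x \<in> U \<Longrightarrow> x powi i \<in> U"
proof -
  show 1: "1 \<in> U" "x \<in> U \<Longrightarrow> y \<in> U \<Longrightarrow> x * y \<in> U" "x \<in> U \<Longrightarrow> inverse x \<in> U" for x y
    by (simp_all add: U_def power_mult_distrib power_inverse)
  show 2: "x \<in> U \<Longrightarrow> x ^ k \<in> U" for x k
    by (induction k) (auto simp: 1)
  show "x \<in> U \<Longrightarrow> x powi i \<in> U" for i
    by (simp add: power_int_def 1 2)
qed

lemma U_powi_q: "x \<in> U \<Longrightarrow> (x powi i) ^ q = x powi (- i)"
  using U_pow_q[OF U_powi] by (simp add: power_int_minus)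

lemma pow_mod_n: "x \<in> U \<Longrightarrow> x ^ (k mod n) = x ^ k"
proof -
  assume x: "x \<in> U"
  have "x ^ k = x ^ (n * (k div n) + k mod n)" by simp
  also have "\<dots> = x ^ (k mod n)"
    unfolding power_add power_mult using x by (simp add: U_def)
  finally show ?thesis by simp
qed

lemma U_pow_cong: "x \<in> U \<Longrightarrow> [i = j] (mod n) \<Longrightarrow> x ^ i = x ^ j"
  by (metis pow_mod_n cong_def)

lemma U_powi_cong:
  assumes x: "x \<in> U" and ij: "[i = j] (mod int n)"
  shows "x powi i = x powi j"
proof -
  obtain k where "j = i + int n * k" using ij by (metis cong_iff_lin)
  moreover have "x powi (int n * k) = 1"
    using x by (simp add: power_int_mult U_def)
  ultimately show ?thesis using U_nonzero[OF x] by (simp add: power_int_add)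
qed

lemma beta_U: "\<beta> \<in> U"
  using prim by (simp add: U_def primitive_root_of_unity_def)

lemma inj_beta: "inj_on (\<lambda>i. \<beta> ^ i) {..<n}"
proof (rule linorder_inj_onI')
  fix i j assume ij: "i \<in> {..<n}" "j \<in> {..<n}" "i < j"
  have "\<beta> ^ (j - i) \<noteq> 1" using prim ij by (auto simp: primitive_root_of_unity_def)
  moreover have "\<beta> ^ j = \<beta> ^ i * \<beta> ^ (j - i)" using ij by (simp flip: power_add)
  ultimately show "\<beta> ^ i \<noteq> \<beta> ^ j" using U_nonzero[OF beta_U] by auto
qed

lemma U_eq: "U = (\<lambda>i. \<beta> ^ i) ` {..<n}" and card_U: "card U = n"
proof -
  let ?p = "Polynomial.monom 1 n - 1 :: 'b poly"
  have "poly.coeff ?p n = 1" using n_ge by simp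
  then have p0: "?p \<noteq> 0" by (metis coeff_0 zero_neq_one)
  have "degree ?p \<le> n" by (intro degree_diff_le) (auto simp: degree_monom_eq)
  moreover have "U = {x. poly ?p x = 0}" by (auto simp: U_def poly_monom add_eq_0_b)
  ultimately have "card U \<le> n"
    using card_poly_roots_bound[OF p0] by simp
  moreover have sub: "(\<lambda>i. \<beta> ^ i) ` {..<n} \<subseteq> U" using beta_U U_power by auto
  moreover have c: "card ((\<lambda>i. \<beta> ^ i) ` {..<n}) = n" by (simp add: card_image inj_beta)
  ultimately show "U = (\<lambda>i. \<beta> ^ i) ` {..<n}" by (metis card_seteq finite)
  then show "card U = n" using c by simp
qed

lemma beta_pow_eq_1: "\<beta> ^ k = 1 \<longleftrightarrow> n dvd k"
proof -
  have "\<beta> ^ (k mod n) = \<beta> ^ 0 \<longleftrightarrow> k mod n = 0"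
    using n_ge by (intro inj_on_eq_iff[OF inj_beta]) auto
  then show ?thesis by (simp add: pow_mod_n[OF beta_U] dvd_eq_mod_eq_0)
qed

lemma beta_powi_eq_1: "\<beta> powi i = 1 \<longleftrightarrow> int n dvd i"
proof -
  have "\<beta> powi i = \<beta> powi (i mod int n)"
    by (rule U_powi_cong[OF beta_U]) (simp add: cong_def)
  also have "\<dots> = \<beta> ^ nat (i mod int n)"
    using n_ge by (simp add: power_int_def)
  finally show ?thesis
    using n_ge by (simp add: beta_pow_eq_1 dvd_mod_iff flip: int_dvd_int_iff)
qed

text \<open>Orthogonality of characters. The trivial character sums to \<open>n\<close>, which is 1
  because \<open>n\<close> is odd and the characteristic is two.\<close>

lemma U_sum_power: "(\<Sum>x\<in>U. x ^ k) = (if n dvd k then 1 else 0)"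
proof -
  have "(\<Sum>x\<in>U. x ^ k) = (\<Sum>i<n. (\<beta> ^ k) ^ i)"
    unfolding U_eq by (subst sum.reindex[OF inj_beta]) (simp add: mult.commute flip: power_mult)
  also have "\<dots> = (if n dvd k then 1 else 0)"
  proof (cases "n dvd k")
    case True
    then have "\<beta> ^ k = 1" by (simp add: beta_pow_eq_1)
    then show ?thesis using True odd_n by (simp add: of_nat_b)
  next
    case False
    then have "\<beta> ^ k \<noteq> 1" by (simp add: beta_pow_eq_1)
    moreover have "(\<beta> ^ k) ^ n = 1" using U_power[OF beta_U] by (simp add: U_def)
    ultimately show ?thesis using False by (simp add: sum_gp_strict)
  qed
  finally show ?thesis .
qed

end

section \<open>Cyclic codes with two zeros\<close>

text \<open>Dividing a polynomial with root \<open>x\<close> by a monic one of least degree leaves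
  remainder 0. The same argument gives the uniqueness behind the definite description in
  \<open>min_poly\<close>; \<open>ex\<close> supplies existence.\<close>

lemma min_poly_dvd_iff:
  fixes emb :: "'a::field_gcd \<Rightarrow> 'b::field"
  assumes hom: "field_hom emb" and ex: "\<exists>r. r \<noteq> 0 \<and> poly (map_poly emb r) x = 0"
  shows "min_poly emb x dvd r \<longleftrightarrow> poly (map_poly emb r) x = 0"
proof -
  interpret emb: field_hom emb by (rule hom)
  interpret emb_poly: map_poly_idom_hom emb by unfold_locales
  define root where "root r \<longleftrightarrow> poly (map_poly emb r) x = 0" for r
  obtain p0 where p0: "p0 \<noteq> 0" "root p0" "\<And>r. r \<noteq> 0 \<Longrightarrow> root r \<Longrightarrow> degree p0 \<le> degree r"
  proof -
    obtain r0 where "r0 \<noteq> 0 \<and> root r0" using ex unfolding root_def by blast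
    from ex_has_least_nat[where P = "\<lambda>r. r \<noteq> 0 \<and> root r", OF this, of degree]
    show ?thesis using that by auto
  qed
  define p where "p = Polynomial.smult (inverse (lead_coeff p0)) p0"
  have p: "lead_coeff p = 1" "root p" "\<And>r. r \<noteq> 0 \<Longrightarrow> root r \<Longrightarrow> degree p \<le> degree r"
    using p0 by (auto simp: p_def root_def hom_distribs)
  have dvd: "s dvd r" if "lead_coeff s = 1" "root s" "root r"
    "\<And>r. r \<noteq> 0 \<Longrightarrow> root r \<Longrightarrow> degree s \<le> degree r" for r s
  proof -
    have s0: "s \<noteq> 0" using that(1) by auto
    have "r = r div s * s + r mod s" by simp
    then have "map_poly emb r = map_poly emb (r div s) * map_poly emb s + map_poly emb (r mod s)"
      by (metis emb_poly.hom_add emb_poly.hom_mult)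
    then have "root (r mod s)" using that by (simp add: root_def)
    then have "r mod s = 0"
      using that(4)[of "r mod s"] degree_mod_less[OF s0, of r] by linarith
    then show ?thesis by auto
  qed
  have "min_poly emb x = p"
    unfolding min_poly_def root_def[symmetric]
  proof (rule the_equality)
    show "lead_coeff p = 1 \<and> root p \<and> (\<forall>r. r \<noteq> 0 \<and> root r \<longrightarrow> degree p \<le> degree r)"
      using p by blast
    fix s assume "lead_coeff s = 1 \<and> root s \<and> (\<forall>r. r \<noteq> 0 \<and> root r \<longrightarrow> degree s \<le> degree r)"
    then show "s = p" using p dvd by (intro poly_dvd_antisym) auto
  qed
  moreover have "root r" if "p dvd r"
    using that p(2) by (auto simp: root_def hom_distribs elim!: dvdE)
  ultimately show ?thesis using p dvd[of p r] by (auto simp: root_def)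
qed

lemma words_iff: "c \<in> words N \<longleftrightarrow> c = 0 \<or> degree c < N"
proof
  assume "c \<in> words N"
  then show "c = 0 \<or> degree c < N"
    using leading_coeff_0_iff[of c] by (force simp: words_def not_less)
qed (auto simp: words_def intro: coeff_eq_0)

interpretation poly_vs: vector_space "Polynomial.smult :: 'a::field \<Rightarrow> 'a poly \<Rightarrow> 'a poly"
  by unfold_locales (simp_all add: smult_add_left smult_add_right)

lemma subspace_multiples: "poly_vs.subspace {c \<in> words N. g dvd c}"
  by (auto simp: poly_vs.subspace_def words_def intro: dvd_smult)

text \<open>The multiples of \<open>g\<close> by monomials, taken as long as their degree stays
  below \<open>N\<close>, form a basis. The truncated difference is also right when
  \<open>degree g\<close> exceeds \<open>N\<close>: only 0 is left.\<close>

lemma dim_multiples: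
  fixes g :: "'a::field_gcd poly"
  assumes g: "g \<noteq> 0"
  shows "poly_vs.dim {c \<in> words N. g dvd c} = N - degree g"
proof -
  define b where "b i = Polynomial.monom 1 i * g" for i
  define k where "k = N - degree g"
  have deg_b: "degree (b i) = i + degree g" for i
    using g by (simp add: b_def degree_mult_eq degree_monom_eq monom_eq_0_iff)
  have inj: "inj_on b I" for I by (rule inj_onI) (metis deg_b add_right_cancel)
  have sum_b: "(\<Sum>i<k. Polynomial.smult (f i) (b i)) = (\<Sum>i<k. Polynomial.monom (f i) i) * g" for f
    by (simp add: b_def sum_distrib_right smult_monom flip: mult_smult_left)
  show ?thesis
  proof (rule poly_vs.dim_unique)
    show "b ` {..<k} \<subseteq> {c \<in> words N. g dvd c}"
      by (auto simp: words_iff deg_b k_def) (simp add: b_def)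
    show "card (b ` {..<k}) = N - degree g" by (simp add: card_image[OF inj] k_def)
    show "poly_vs.independent (b ` {..<k})"
    proof (rule poly_vs.independent_if_scalars_zero)
      fix f x assume sum0: "(\<Sum>x\<in>b ` {..<k}. Polynomial.smult (f x) x) = 0" and "x \<in> b ` {..<k}"
      then obtain j where j: "j < k" "x = b j" by auto
      have "(\<Sum>i<k. Polynomial.monom (f (b i)) i) * g = 0"
        using sum0 sum_b[of "\<lambda>i. f (b i)"] by (simp add: sum.reindex[OF inj])
      then have "poly.coeff (\<Sum>i<k. Polynomial.monom (f (b i)) i) j = 0" using g by simp
      then show "f x = 0" using j by (simp add: coeff_sum)
    qed simp
    show "{c \<in> words N. g dvd c} \<subseteq> poly_vs.span (b ` {..<k})"
    proof
      fix c assume "c \<in> {c \<in> words N. g dvd c}"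
      then obtain a where c: "c = g * a" and "g * a \<in> words N" by (auto elim!: dvdE)
      have "a = (\<Sum>i<k. Polynomial.monom (poly.coeff a i) i)"
      proof (rule poly_eqI)
        fix i
        have "poly.coeff a i = 0" if "i \<ge> k"
          using \<open>g * a \<in> words N\<close> g that
          by (cases "a = 0") (auto simp: words_iff degree_mult_eq k_def intro!: coeff_eq_0)
        then show "poly.coeff a i = poly.coeff (\<Sum>i<k. Polynomial.monom (poly.coeff a i) i) i"
          by (simp add: coeff_sum)
      qed
      then have "g * a = (\<Sum>i<k. Polynomial.smult (poly.coeff a i) (b i))"
        by (simp add: sum_b mult.commute)
      moreover have "(\<Sum>i<k. Polynomial.smult (poly.coeff a i) (b i)) \<in> poly_vs.span (b ` {..<k})"
        by (rule poly_vs.span_sum, rule poly_vs.span_scale, rule poly_vs.span_base) simp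
      ultimately show "c \<in> poly_vs.span (b ` {..<k})" by (simp add: c)
    qed
  qed
qed

lemma hamming_dist_diff: "hamming_dist N c c' = hamming_dist N (c - c') 0"
  by (simp add: hamming_dist_def)

section \<open>The code as the multiples of \<open>gen h\<close>: zeros, dimension and the MDS
  property\<close>

context norm_one_group
begin

sublocale emb_poly: map_poly_idom_hom emb by unfold_locales

abbreviation evalp :: "'a poly \<Rightarrow> 'b \<Rightarrow> 'b" where "evalp c x \<equiv> poly (map_poly emb c) x"

lemma evalp_pow_q: "evalp c x ^ q = evalp c (x ^ q)"
proof -
  have emb_q: "emb a ^ q = emb a" for a using range_emb by (auto simp: Fq_def)
  show ?thesis
    using q_ge by (induction c) (simp_all add: pow_q_add power_mult_distrib emb_q zero_power hom_distribs)
qed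

text \<open>Conjugation inverts \<open>\<beta> powi i\<close>, so the two prescribed zeros of a
  codeword bring two more.\<close>

lemma evalp_conj: "evalp c (\<beta> powi i) = 0 \<Longrightarrow> evalp c (\<beta> powi (- i)) = 0"
  using evalp_pow_q[of c "\<beta> powi i"] q_ge by (simp add: U_powi_q[OF beta_U] zero_power)

lemma evalp_unity_poly: "x \<in> U \<Longrightarrow> evalp (Polynomial.monom 1 n - 1) x = 0"
  by (simp add: U_def hom_distribs poly_monom)

lemma degree_unity_poly: "degree (Polynomial.monom 1 n - 1 :: 'a poly) = n"
  using n_ge by (subst diff_conv_add_uminus, subst degree_add_eq_left) (auto simp: degree_monom_eq)

lemma unity_poly_nonzero: "Polynomial.monom 1 n - 1 \<noteq> (0 :: 'a poly)"
  using n_ge degree_unity_poly by auto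

lemma min_poly_dvd_iff_U: "x \<in> U \<Longrightarrow> min_poly emb x dvd r \<longleftrightarrow> evalp r x = 0"
  using unity_poly_nonzero evalp_unity_poly by (intro min_poly_dvd_iff[OF emb_hom]) blast

definition gen :: "int \<Rightarrow> 'a poly" where
  "gen h = lcm (min_poly emb (\<beta> powi h)) (min_poly emb (\<beta> powi (h + 1)))"

lemma gen_dvd_iff:
  "gen h dvd c \<longleftrightarrow> evalp c (\<beta> powi h) = 0 \<and> evalp c (\<beta> powi (h + 1)) = 0"
  by (simp add: gen_def min_poly_dvd_iff_U U_powi[OF beta_U])

lemma gen_nonzero: "gen h \<noteq> 0"
  using gen_dvd_iff[of h "Polynomial.monom 1 n - 1"] unity_poly_nonzero evalp_unity_poly
  by (auto simp: U_powi[OF beta_U])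

text \<open>\<open>gen h\<close> divides the modulus, so reduction preserves divisibility by it;
  conversely a multiple of degree below \<open>n\<close> is its own reduction.\<close>

lemma BCH_code_eq: "BCH_code_3 emb \<beta> n h = {c \<in> words n. gen h dvd c}"
proof -
  let ?f = "Polynomial.monom 1 n - 1 :: 'a poly"
  have g: "gen h dvd ?f" by (simp add: gen_dvd_iff evalp_unity_poly U_powi[OF beta_U])
  have "c \<in> cyclic_code n (gen h) \<longleftrightarrow> c \<in> words n \<and> gen h dvd c" for c
  proof
    assume "c \<in> cyclic_code n (gen h)"
    then obtain a where c: "c = (a * gen h) mod ?f" by (auto simp: cyclic_code_def)
    have "degree c < n \<or> c = 0"
      using degree_mod_less[OF unity_poly_nonzero, of "a * gen h"] c degree_unity_poly by auto
    moreover have "gen h dvd c" using g c by (simp add: dvd_mod_iff)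
    ultimately show "c \<in> words n \<and> gen h dvd c" by (auto simp: words_iff)
  next
    assume c: "c \<in> words n \<and> gen h dvd c"
    then obtain a where a: "c = a * gen h" by (metis dvd_def mult.commute)
    have "c mod ?f = c"
      using c n_ge by (auto simp: words_iff degree_unity_poly intro!: mod_poly_less)
    then show "c \<in> cyclic_code n (gen h)" using a by (auto simp: cyclic_code_def intro!: exI[of _ a])
  qed
  then show ?thesis by (auto simp: BCH_code_3_def gen_def)
qed

text \<open>Each prescribed zero is a root of a quadratic over the small field, which gives at most
  4. The zeros and their conjugates have the exponents \<open>h\<close>, \<open>- h\<close>,
  \<open>h + 1\<close> and \<open>- (h + 1)\<close>; as \<open>n\<close> is odd, the hypotheses make
  these distinct modulo \<open>n\<close>.\<close>

lemma degree_gen: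
  assumes h: "\<not> int n dvd h" "\<not> int n dvd h + 1" "\<not> int n dvd 2 * h + 1"
  shows "degree (gen h) = 4"
proof (rule antisym)
  have quad: "\<exists>Q. Q \<noteq> 0 \<and> degree Q \<le> 2 \<and> evalp Q (\<beta> powi i) = 0" for i
  proof -
    let ?x = "\<beta> powi i"
    have x: "?x \<in> U" "?x \<noteq> 0" using U_powi[OF beta_U] U_nonzero by blast+
    \<comment> \<open>This is the trace of \<open>?x\<close>; as the norm is 1,
      \<open>[:1, a, 1:]\<close> has the roots \<open>?x\<close> and
      \<open>inverse ?x\<close>.\<close>
    have "?x + inverse ?x \<in> Fq"
      using U_pow_q[OF x(1)] U_pow_q[OF U_inverse[OF x(1)]]
      by (simp add: Fq_def pow_q_add add.commute)
    then obtain a where "emb a = ?x + inverse ?x" using range_emb by (metis rangeE)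
    then have "evalp [:1, a, 1:] ?x = 0"
      using x(2) by (simp add: hom_distribs algebra_simps)
    then show ?thesis by (intro exI[of _ "[:1, a, 1:]"]) auto
  qed
  obtain Q Q' where Q: "Q \<noteq> 0" "degree Q \<le> 2" "evalp Q (\<beta> powi h) = 0"
    "Q' \<noteq> 0" "degree Q' \<le> 2" "evalp Q' (\<beta> powi (h + 1)) = 0" using quad by metis
  have "gen h dvd Q * Q'" using Q by (simp add: gen_dvd_iff hom_distribs)
  then have "degree (gen h) \<le> degree (Q * Q')" using Q by (intro dvd_imp_degree_le) auto
  also have "\<dots> \<le> 4" using Q by (simp add: degree_mult_eq)
  finally show "degree (gen h) \<le> 4" .
  let ?G = "map_poly emb (gen h)"
  have G0: "?G \<noteq> 0" using gen_nonzero by simp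
  have roots: "evalp (gen h) (\<beta> powi h) = 0" "evalp (gen h) (\<beta> powi (h + 1)) = 0"
    using gen_dvd_iff[of h "gen h"] by auto
  let ?S = "{\<beta> powi h, \<beta> powi (- h), \<beta> powi (h + 1), \<beta> powi (- (h + 1))}"
  have "\<beta> \<noteq> 0" using U_nonzero beta_U by blast
  then have powi_eq: "\<beta> powi i = \<beta> powi j \<longleftrightarrow> int n dvd i - j" for i j
    using beta_powi_eq_1[of "i - j"] by (simp add: power_int_diff)
  have two: "int n dvd 2 * i \<longleftrightarrow> int n dvd i" for i
    using odd_n by (intro coprime_dvd_mult_right_iff) simp
  have n1: "\<not> int n dvd 1" using n_ge by auto
  have ne: "\<beta> powi i \<noteq> \<beta> powi j"
    if "i - j \<in> {2 * h, 2 * (h + 1), - 1, 1, 2 * h + 1, - (2 * h + 1)}" for i j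
    using that h n1 unfolding powi_eq by (auto simp only: two dvd_minus_iff insert_iff empty_iff)
  have "4 = card ?S"
    using ne[of h "- h"] ne[of h "h + 1"] ne[of h "- (h + 1)"] ne[of "- h" "h + 1"]
      ne[of "- h" "- (h + 1)"] ne[of "h + 1" "- (h + 1)"] by simp
  also have "\<dots> \<le> card {x. poly ?G x = 0}"
    using roots evalp_conj[OF roots(1)] evalp_conj[OF roots(2)] by (intro card_mono) auto
  also have "\<dots> \<le> degree (gen h)" using card_poly_roots_bound[OF G0] by simp
  finally show "4 \<le> degree (gen h)" .
qed

text \<open>The dimension is \<open>n - 4\<close>, so MDS means minimum distance 5, and by linearity
  distances are weights. If no nonzero word is lighter, the value 5 is attained by
  \<open>gen h\<close>, which has at most five nonzero coefficients.\<close>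

lemma MDS_iff:
  assumes h: "\<not> int n dvd h" "\<not> int n dvd h + 1" "\<not> int n dvd 2 * h + 1"
  shows "MDS_code n (BCH_code_3 emb \<beta> n h) \<longleftrightarrow>
    (\<forall>c\<in>words n. c \<noteq> 0 \<longrightarrow> evalp c (\<beta> powi h) = 0 \<longrightarrow> evalp c (\<beta> powi (h + 1)) = 0 \<longrightarrow>
       5 \<le> hamming_dist n c 0)"
proof -
  let ?C = "{c \<in> words n. gen h dvd c}"
  have dim: "poly_vs.dim ?C = n - 4"
    using dim_multiples[OF gen_nonzero[of h]] by (simp add: degree_gen[OF h])
  have zero: "0 \<in> ?C" by (simp add: words_iff)
  have diff: "c - c' \<in> ?C" if "c \<in> ?C" "c' \<in> ?C" for c c'
    using poly_vs.subspace_diff[OF subspace_multiples that] .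
  have "MDS_code n ?C \<longleftrightarrow> (\<forall>c\<in>?C. c \<noteq> 0 \<longrightarrow> 5 \<le> hamming_dist n c 0)"
  proof
    assume "MDS_code n ?C"
    then obtain k d where kd: "linear_code n k d ?C" "int d = int n - int k + 1"
      by (auto simp: MDS_code_def)
    then have "k = n - 4" using dim by (simp add: linear_code_def)
    then have "d = 5" using kd(2) n_ge by simp
    then show "\<forall>c\<in>?C. c \<noteq> 0 \<longrightarrow> 5 \<le> hamming_dist n c 0"
      using kd(1) zero unfolding linear_code_def by blast
  next
    assume wt: "\<forall>c\<in>?C. c \<noteq> 0 \<longrightarrow> 5 \<le> hamming_dist n c 0"
    have gC: "gen h \<in> ?C" using n_ge by (simp add: words_iff degree_gen[OF h])
    have "{i. i < n \<and> poly.coeff (gen h) i \<noteq> 0} \<subseteq> {..4}"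
      using le_degree[of "gen h"] degree_gen[OF h] by auto
    then have "hamming_dist n (gen h) 0 \<le> card {..4::nat}"
      unfolding hamming_dist_def by (intro card_mono) auto
    then have "hamming_dist n (gen h) 0 = 5"
      using wt gC gen_nonzero[of h] by (simp add: order_antisym)
    moreover have "5 \<le> hamming_dist n c c'" if "c \<in> ?C" "c' \<in> ?C" "c \<noteq> c'" for c c'
      using wt diff[OF that(1,2)] that(3) by (subst hamming_dist_diff) auto
    ultimately have "linear_code n (n - 4) 5 ?C"
      unfolding linear_code_def using gC zero gen_nonzero[of h] subspace_multiples dim by blast
    moreover have "int 5 = int n - int (n - 4) + 1" using n_ge by simp
    ultimately show "MDS_code n ?C" unfolding MDS_code_def by blast
  qed
  then show ?thesis by (auto simp: BCH_code_eq gen_dvd_iff)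
qed

section \<open>Cross ratios and words of weight at most four\<close>

lemma evalp_eq_sum:
  assumes "finite I" and "\<And>i. i \<notin> I \<Longrightarrow> poly.coeff c i = 0"
  shows "evalp c x = (\<Sum>i\<in>I. emb (poly.coeff c i) * x ^ i)"
proof -
  have "evalp c x = (\<Sum>i\<le>degree c. emb (poly.coeff c i) * x ^ i)"
    by (simp add: poly_altdef)
  also have "\<dots> = (\<Sum>i\<in>{..degree c} \<union> I. emb (poly.coeff c i) * x ^ i)"
    using assms(1) by (intro sum.mono_neutral_left) (auto intro: coeff_eq_0)
  also have "\<dots> = (\<Sum>i\<in>I. emb (poly.coeff c i) * x ^ i)"
    using assms by (intro sum.mono_neutral_right) auto
  finally show ?thesis .
qed

text \<open>The classical cross ratio of the pairs \<open>x1\<close>, \<open>x4\<close> and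
  \<open>x2\<close>, \<open>x3\<close>, whose signs disappear in characteristic two.\<close>

definition cross_ratio :: "'b \<Rightarrow> 'b \<Rightarrow> 'b \<Rightarrow> 'b \<Rightarrow> 'b" where
  "cross_ratio x1 x2 x3 x4 = ((x1 + x2) * (x4 + x3)) / ((x1 + x3) * (x4 + x2))"

lemma inverse_add_inverse:
  "x \<noteq> 0 \<Longrightarrow> y \<noteq> 0 \<Longrightarrow> inverse x + inverse y = (x + y) * (inverse x * inverse y)" for x y :: 'b
  by (simp add: field_simps)

lemma cross_ratio_inverse:
  assumes "x1 \<noteq> 0" "x2 \<noteq> 0" "x3 \<noteq> 0" "x4 \<noteq> 0"
  shows "cross_ratio (inverse x1) (inverse x2) (inverse x3) (inverse x4) = cross_ratio x1 x2 x3 x4"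
  using assms by (simp add: cross_ratio_def inverse_add_inverse mult_ac)

lemma cross_ratio_frobenius:
  "cross_ratio (x1 ^ 2 ^ e) (x2 ^ 2 ^ e) (x3 ^ 2 ^ e) (x4 ^ 2 ^ e) = cross_ratio x1 x2 x3 x4 ^ 2 ^ e"
  by (simp add: cross_ratio_def power_divide power_mult_distrib flip: frobenius)

text \<open>Raising to the power \<open>q\<close> inverts the four points, and inversion preserves
  cross ratios.\<close>

lemma cross_ratio_Fq:
  assumes "x1 \<in> U" "x2 \<in> U" "x3 \<in> U" "x4 \<in> U"
  shows "cross_ratio x1 x2 x3 x4 \<in> Fq"
  using assms cross_ratio_frobenius[of x1 m x2 x3 x4]
  by (simp add: Fq_def U_pow_q cross_ratio_inverse U_nonzero flip: q_eq)

lemma cross_ratio_ne: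
  assumes "x1 \<noteq> x2" "x1 \<noteq> x3" "x1 \<noteq> x4" "x2 \<noteq> x3" "x2 \<noteq> x4" "x3 \<noteq> x4"
  shows "cross_ratio x1 x2 x3 x4 \<notin> {0, 1}"
proof -
  have "(x1 + x4) * (x2 + x3) \<noteq> 0" using assms by (simp add: add_eq_0_b)
  \<comment> \<open>Numerator and denominator sum to a product that is nonzero for distinct points,
    so the ratio is not 1.\<close>
  moreover have "(x1 + x2) * (x4 + x3) + (x1 + x3) * (x4 + x2) = (x1 + x4) * (x2 + x3)"
    by (simp add: algebra_simps)
  ultimately have "(x1 + x2) * (x4 + x3) \<noteq> (x1 + x3) * (x4 + x2)"
    by (metis add_self)
  then show ?thesis using assms by (simp add: cross_ratio_def add_eq_0_b)
qed

text \<open>By Bezout some multiple of \<open>e\<close> has the form \<open>m * y + 1\<close>, so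
  iterating the two fixed-point equations gives \<open>r = r ^ 2\<close>.\<close>

lemma Frobenius_fixed:
  assumes r: "r \<in> Fq" "r ^ 2 ^ e = r" and e: "coprime e m"
  shows "r \<in> {0, 1}"
proof -
  have iterate: "r ^ 2 ^ (a * k) = r" if "r ^ 2 ^ a = r" for a k
    by (induction k) (simp_all add: that power_add power_mult)
  have r_m: "r ^ 2 ^ m = r" using r(1) by (simp add: Fq_def flip: q_eq)
  have "e \<noteq> 0" using e m_ge by (metis coprime_0_left_iff nat_dvd_1_iff_1 numeral_le_one_iff semiring_norm(70))
  then obtain x y where xy: "e * x = m * y + 1" using bezout_nat[of e m] e by auto
  have "r = r ^ 2 ^ (m * y + 1)" using iterate[OF r(2), of x] xy by simp
  also have "\<dots> = (r ^ 2 ^ (m * y)) ^ 2" by (simp add: power_mult[symmetric] mult.commute)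
  also have "\<dots> = r ^ 2" using iterate[of m y] r_m by simp
  finally have "r * r = r * 1" by (simp add: power2_eq_square)
  then show ?thesis unfolding mult_cancel_left by auto
qed

text \<open>The weighted sum of \<open>(x i + A) * (y i + B)\<close> vanishes for all
  \<open>A\<close> and \<open>B\<close>. Two choices kill the terms of \<open>p\<close> and
  \<open>r\<close>, leaving two relations between \<open>\<gamma> j\<close> and
  \<open>\<gamma> s\<close>; eliminating these weights gives the claim.\<close>

lemma four_point_relation:
  fixes \<gamma> x y :: "nat \<Rightarrow> 'b"
  assumes I: "I = {j, p, r, s}" "distinct [j, p, r, s]"
    and rel: "(\<Sum>i\<in>I. \<gamma> i) = 0" "(\<Sum>i\<in>I. \<gamma> i * x i) = 0"
      "(\<Sum>i\<in>I. \<gamma> i * y i) = 0" "(\<Sum>i\<in>I. \<gamma> i * x i * y i) = 0"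
    and inj: "inj_on x I" "inj_on y I"
    and "\<gamma> j \<noteq> 0"
  shows "cross_ratio (x j) (x p) (x r) (x s) = cross_ratio (y j) (y p) (y r) (y s)"
proof -
  have comb: "(\<Sum>i\<in>I. \<gamma> i * ((x i + A) * (y i + B))) = 0" for A B
  proof -
    have "(\<Sum>i\<in>I. \<gamma> i * ((x i + A) * (y i + B))) = (\<Sum>i\<in>I. \<gamma> i * x i * y i) +
      (\<Sum>i\<in>I. \<gamma> i * x i) * B + (\<Sum>i\<in>I. \<gamma> i * y i) * A + (\<Sum>i\<in>I. \<gamma> i) * A * B"
      by (simp add: algebra_simps sum.distrib sum_distrib_left)
    then show ?thesis by (simp add: rel)
  qed
  have 1: "\<gamma> j * ((x j + x p) * (y j + y r)) = \<gamma> s * ((x s + x p) * (y s + y r))"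
    using comb[of "x p" "y r"] I by (simp add: add_eq_0_b)
  have 2: "\<gamma> j * ((x j + x r) * (y j + y p)) = \<gamma> s * ((x s + x r) * (y s + y p))"
    using comb[of "x r" "y p"] I by (simp add: add_eq_0_b)
  have ne: "x j + x r \<noteq> 0" "x s + x p \<noteq> 0" "y j + y r \<noteq> 0" "y s + y p \<noteq> 0"
    using I inj by (auto simp: add_eq_0_b dest: inj_onD)
  have "\<gamma> s \<noteq> 0" using 1 \<open>\<gamma> j \<noteq> 0\<close> I inj by (auto simp: add_eq_0_b dest: inj_onD)
  have "\<gamma> j * ((x j + x p) * (y j + y r)) * (\<gamma> s * ((x s + x r) * (y s + y p))) =
    \<gamma> s * ((x s + x p) * (y s + y r)) * (\<gamma> j * ((x j + x r) * (y j + y p)))"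
    by (simp only: 1 2)
  then have "\<gamma> j * \<gamma> s * ((x j + x p) * (x s + x r) * ((y j + y r) * (y s + y p))) =
    \<gamma> j * \<gamma> s * ((y j + y p) * (y s + y r) * ((x j + x r) * (x s + x p)))"
    by (simp only: mult_ac)
  then have "(x j + x p) * (x s + x r) * ((y j + y r) * (y s + y p)) =
    (y j + y p) * (y s + y r) * ((x j + x r) * (x s + x p))"
    using \<open>\<gamma> s \<noteq> 0\<close> \<open>\<gamma> j \<noteq> 0\<close> by (simp only: mult_cancel_left) simp
  then show ?thesis using ne by (simp add: cross_ratio_def frac_eq_eq)
qed

text \<open>A nonzero word of weight at most 4 has the zeros with exponents \<open>h\<close>,
  \<open>h + 1\<close> and their negatives. These four equations have the shape of
  \<open>four_point_relation\<close>, so a cross ratio in \<open>Fq\<close> equals its own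
  \<open>2 ^ e\<close>-th power. By \<open>Frobenius_fixed\<close> it is 0 or 1, impossible for
  distinct points.\<close>

lemma weight_ge_5:
  assumes e: "coprime e m"
    and k: "[2 * h + 1 = 2 ^ e] (mod int n) \<or> [2 * h + 1 = - (2 ^ e)] (mod int n)"
    and c: "c \<in> words n" "c \<noteq> 0" "evalp c (\<beta> powi h) = 0" "evalp c (\<beta> powi (h + 1)) = 0"
  shows "5 \<le> hamming_dist n c 0"
proof (rule ccontr)
  assume "\<not> 5 \<le> hamming_dist n c 0"
  then have "card {i. i < n \<and> poly.coeff c i \<noteq> 0} \<le> 4" by (simp add: hamming_dist_def)
  moreover have "4 \<le> card {..<n}" using n_ge by simp
  moreover have "{i. i < n \<and> poly.coeff c i \<noteq> 0} \<subseteq> {..<n}" by auto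
  \<comment> \<open>The support is enlarged to exactly four positions, which treats all weights up
    to 4 at once.\<close>
  ultimately obtain I where I: "{i. i < n \<and> poly.coeff c i \<noteq> 0} \<subseteq> I" "I \<subseteq> {..<n}" "card I = 4"
    using exists_subset_between[of "{i. i < n \<and> poly.coeff c i \<noteq> 0}" 4 "{..<n}"] by auto
  have finI: "finite I" using I(2) finite_subset by blast
  have supp: "poly.coeff c i = 0" if "i \<notin> I" for i
    using that I(1) c(1) by (cases "i < n") (auto simp: words_def)
  define j where "j = degree c"
  have j: "poly.coeff c j \<noteq> 0" using c(2) by (simp add: j_def)
  then have "j \<in> I" using supp by blast
  have "card (I - {j}) = 3" using \<open>j \<in> I\<close> I(3) by simp
  then obtain p r s where prs: "I - {j} = {p, r, s}" "p \<noteq> r" "p \<noteq> s" "r \<noteq> s"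
    by (auto simp: card_3_iff)
  have I_eq: "I = {j, p, r, s}" "distinct [j, p, r, s]" using prs \<open>j \<in> I\<close> by auto
  define x where "x i = \<beta> ^ i" for i
  define y where "y i = x i powi (2 * h + 1)" for i
  \<comment> \<open>Scaling by this power turns the exponents \<open>- (h + 1)\<close>,
    \<open>- h\<close>, \<open>h\<close>, \<open>h + 1\<close> into the functions 1,
    \<open>x\<close>, \<open>y\<close>, \<open>x * y\<close>.\<close>
  define \<gamma> where "\<gamma> i = emb (poly.coeff c i) * x i powi (- (h + 1))" for i
  have xU: "x i \<in> U" for i unfolding x_def by (rule U_power[OF beta_U])
  have x0: "x i \<noteq> 0" for i using xU U_nonzero by blast
  have inj: "inj_on x I" unfolding x_def using inj_beta I(2) by (rule inj_on_subset)
  have ev: "(\<Sum>i\<in>I. emb (poly.coeff c i) * x i powi a) = 0" if "evalp c (\<beta> powi a) = 0" for a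
  proof -
    have "(\<beta> powi a) ^ i = x i powi a" for i
      unfolding x_def by (simp add: mult.commute flip: power_int_mult power_int_of_nat)
    then show ?thesis using that by (subst (asm) evalp_eq_sum[OF finI supp]) auto
  qed
  have sums: "(\<Sum>i\<in>I. \<gamma> i) = 0" "(\<Sum>i\<in>I. \<gamma> i * x i) = 0"
      "(\<Sum>i\<in>I. \<gamma> i * y i) = 0" "(\<Sum>i\<in>I. \<gamma> i * x i * y i) = 0"
  proof -
    have \<gamma>_mult: "\<gamma> i * x i = emb (poly.coeff c i) * x i powi (- h)"
      "\<gamma> i * y i = emb (poly.coeff c i) * x i powi h"
      "\<gamma> i * x i * y i = emb (poly.coeff c i) * x i powi (h + 1)" for i
    proof -
      have "x i powi (- (h + 1)) * x i = x i powi (- (h + 1) + 1)"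
        "x i powi (- (h + 1)) * y i = x i powi (- (h + 1) + (2 * h + 1))"
        "x i powi (- (h + 1)) * x i * y i = x i powi (- (h + 1) + 1 + (2 * h + 1))"
        unfolding y_def using x0[of i] by (simp_all only: power_int_add disj_not1 power_int_1_right simp_thms)
      then show "\<gamma> i * x i = emb (poly.coeff c i) * x i powi (- h)"
      "\<gamma> i * y i = emb (poly.coeff c i) * x i powi h"
      "\<gamma> i * x i * y i = emb (poly.coeff c i) * x i powi (h + 1)"
        by (simp_all add: \<gamma>_def mult.assoc)
    qed
    show "(\<Sum>i\<in>I. \<gamma> i) = 0" "(\<Sum>i\<in>I. \<gamma> i * x i) = 0"
      "(\<Sum>i\<in>I. \<gamma> i * y i) = 0" "(\<Sum>i\<in>I. \<gamma> i * x i * y i) = 0"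
      using ev[OF c(3)] ev[OF c(4)] ev[OF evalp_conj[OF c(3)]] ev[OF evalp_conj[OF c(4)]]
      unfolding \<gamma>_mult(3) unfolding \<gamma>_mult(1,2) by (simp_all add: \<gamma>_def)
  qed
  have y: "(\<forall>i. y i = x i ^ 2 ^ e) \<or> (\<forall>i. y i = inverse (x i ^ 2 ^ e))"
  proof -
    have "y i = x i powi (2 ^ e)" if "[2 * h + 1 = 2 ^ e] (mod int n)" for i
      unfolding y_def by (rule U_powi_cong[OF xU that])
    moreover have "y i = x i powi - (2 ^ e)" if "[2 * h + 1 = - (2 ^ e)] (mod int n)" for i
      unfolding y_def by (rule U_powi_cong[OF xU that])
    moreover have "x i powi (2 ^ e) = x i ^ 2 ^ e" for i
      by (metis of_nat_numeral of_nat_power power_int_of_nat)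
    ultimately show ?thesis using k by (auto simp: power_int_minus)
  qed
  \<comment> \<open>The negative sign only inverts the four points, which leaves their cross ratio
    unchanged.\<close>
  have cr_y: "cross_ratio (y j) (y p) (y r) (y s) = cross_ratio (x j) (x p) (x r) (x s) ^ 2 ^ e"
    using y x0 by (auto simp: cross_ratio_inverse cross_ratio_frobenius)
  have inj_frob: "a = b" if "a ^ 2 ^ e = b ^ 2 ^ e" for a b :: 'b
  proof -
    have "(a + b) ^ 2 ^ e = 0" using that by (simp add: frobenius)
    then show ?thesis by (simp add: add_eq_0_b)
  qed
  have "inj_on y I"
  proof (rule inj_onI)
    fix a b assume ab: "a \<in> I" "b \<in> I" "y a = y b"
    then have "x a ^ 2 ^ e = x b ^ 2 ^ e" using y by auto
    then show "a = b" using inj_frob inj ab by (metis inj_onD)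
  qed
  moreover have "\<gamma> j \<noteq> 0" using j x0 by (simp add: \<gamma>_def)
  ultimately have "cross_ratio (x j) (x p) (x r) (x s) = cross_ratio (x j) (x p) (x r) (x s) ^ 2 ^ e"
    using four_point_relation[OF I_eq sums inj] cr_y by simp
  then have "cross_ratio (x j) (x p) (x r) (x s) \<in> {0, 1}"
    using Frobenius_fixed[OF cross_ratio_Fq[OF xU xU xU xU] _ e] by metis
  moreover have "cross_ratio (x j) (x p) (x r) (x s) \<notin> {0, 1}"
    using I_eq inj by (intro cross_ratio_ne) (auto dest: inj_onD)
  ultimately show False by blast
qed

section \<open>Slopes of the power map in an affine coordinate\<close>

text \<open>The fractional linear map \<open>x \<mapsto> 1 / (x + 1)\<close> takes \<open>U - {1}\<close> to the affine line of the
  elements \<open>t\<close> with \<open>t\<^sup>q = t + 1\<close>, a translate of \<open>Fq\<close>.\<close>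

definition aff :: "'b \<Rightarrow> 'b" where "aff x = inverse (x + 1)"

lemma aff_pow_q:
  assumes "x \<in> U" "x \<noteq> 1"
  shows "aff x ^ q = aff x + 1"
proof -
  have "x + 1 \<noteq> 0" "x \<noteq> 0" using assms U_nonzero by (auto simp: add_eq_0_b)
  moreover have "aff x ^ q = inverse (inverse x + 1)"
    using assms by (simp add: aff_def power_inverse pow_q_add U_pow_q)
  ultimately show ?thesis by (simp add: aff_def field_simps)
qed

lemma aff_add_Fq:
  assumes "x \<in> U" "x \<noteq> 1" "y \<in> U" "y \<noteq> 1"
  shows "aff x + aff y \<in> Fq"
  using assms by (simp add: Fq_def pow_q_add aff_pow_q add_ac)

lemma aff_eq_iff: "aff x = aff y \<longleftrightarrow> x = y"
  by (simp add: aff_def)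

text \<open>Inversion becomes translation by 1, so chords of the graph have the same slopes for an
  exponent and its negative.\<close>

lemma aff_inverse: "x \<noteq> 0 \<Longrightarrow> x \<noteq> 1 \<Longrightarrow> aff (inverse x) = aff x + 1"
  by (simp add: aff_def field_simps add_eq_0_b)

text \<open>Equality of two slopes through the point of \<open>x1\<close> means that three points of
  the graph are collinear. Their affine dependency becomes a nonzero word supported on
  \<open>x1\<close>, \<open>x2\<close>, \<open>x3\<close> and 1, whose weight is too small.\<close>

lemma slopes_distinct:
  assumes wt: "\<And>c. c \<in> words n \<Longrightarrow> c \<noteq> 0 \<Longrightarrow> evalp c (\<beta> powi h) = 0 \<Longrightarrow>
      evalp c (\<beta> powi (h + 1)) = 0 \<Longrightarrow> 5 \<le> hamming_dist n c 0"
    and x: "x1 \<in> U - {1}" "x2 \<in> U - {1}" "x3 \<in> U - {1}" "x1 \<noteq> x2" "x1 \<noteq> x3" "x2 \<noteq> x3"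
    and ne1: "\<And>x. x \<in> U - {1} \<Longrightarrow> x powi (2 * h + 1) \<noteq> 1"
  shows "(aff (x1 powi (2 * h + 1)) + aff (x2 powi (2 * h + 1))) * (aff x1 + aff x3) \<noteq>
    (aff (x1 powi (2 * h + 1)) + aff (x3 powi (2 * h + 1))) * (aff x1 + aff x2)"
proof
  define s where "s x = aff (x powi (2 * h + 1))" for x
  assume "(aff (x1 powi (2 * h + 1)) + aff (x2 powi (2 * h + 1))) * (aff x1 + aff x3) =
    (aff (x1 powi (2 * h + 1)) + aff (x3 powi (2 * h + 1))) * (aff x1 + aff x2)"
  then have slopes: "(s x1 + s x2) * (aff x1 + aff x3) = (s x1 + s x3) * (aff x1 + aff x2)"
    by (simp only: s_def)
  have col: "s x1 * (aff x2 + aff x3) + s x2 * (aff x3 + aff x1) + s x3 * (aff x1 + aff x2) = 0"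
  proof -
    have "s x1 * (aff x2 + aff x3) + s x2 * (aff x3 + aff x1) + s x3 * (aff x1 + aff x2) =
      (s x1 + s x2) * (aff x1 + aff x3) + (s x1 + s x3) * (aff x1 + aff x2)"
      by (simp add: algebra_simps)
    then show ?thesis using slopes by simp
  qed
  \<comment> \<open>Up to the Frobenius-invariant factor \<open>w\<close>, the column of \<open>x\<close> is the tensor product of \<open>(t, t + 1)\<close> and
    \<open>(s, s + 1)\<close>; the codeword below is the affine dependency of the three collinear points \<open>(t, s)\<close>,
    with a correction at \<open>x = 1\<close>, the point at infinity.\<close>
  define w where "w x = x powi h + x powi (- h) + (x powi (h + 1) + x powi (- (h + 1)))" for x :: 'b
  have w: "w x \<in> Fq" "w x \<noteq> 0" "x powi h / w x = aff x * (1 + s x)"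
    "x powi (h + 1) / w x = (1 + aff x) * (1 + s x)" if "x \<in> U - {1}" for x
  proof -
    have x: "x \<in> U" "x \<noteq> 1" "x \<noteq> 0" "x + 1 \<noteq> 0" using that U_nonzero by (auto simp: add_eq_0_b)
    have trace: "x powi i + x powi (- i) \<in> Fq" for i
      using x(1) U_powi_q[of x i] U_powi_q[of x "- i"] by (simp add: Fq_def pow_q_add add.commute)
    show "w x \<in> Fq" unfolding w_def by (rule Fq_add[OF trace trace])
    define z where "z = x powi h"
    have z0: "z \<noteq> 0" using x by (simp add: z_def)
    have y: "x powi (2 * h + 1) = z * z * x"
    proof -
      have "2 * h + 1 = h + h + 1" by simp
      then show ?thesis
        using x(3) by (simp only: z_def power_int_add power_int_1_right simp_thms)
    qed
    have powi: "x powi h = z" "x powi (- h) = inverse z" "x powi (h + 1) = z * x"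
      "x powi (- (h + 1)) = inverse (z * x)"
      using x(3) by (simp_all only: z_def power_int_minus power_int_add power_int_1_right simp_thms)
    have y1: "z * z * x + 1 \<noteq> 0" using ne1[OF that] by (simp add: y add_eq_0_b)
    \<comment> \<open>This factorisation shows that \<open>w\<close> has no zero on
      \<open>U - {1}\<close>, and it splits both quotients into a factor from \<open>x\<close> and
      one from its power.\<close>
    have w_eq: "w x = (x + 1) * (z * z * x + 1) / (z * x)"
      unfolding w_def powi using x z0 by (simp add: field_simps)
    then show "w x \<noteq> 0" using x z0 y1 by simp
    have s: "1 + s x = z * z * x / (z * z * x + 1)"
      unfolding s_def y aff_def using y1 by (simp add: field_simps)
    have t: "1 + aff x = x / (x + 1)"
      using x by (simp add: aff_def field_simps)
    show "x powi h / w x = aff x * (1 + s x)"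
      unfolding s w_eq powi using x z0 by (simp add: aff_def divide_simps)
    show "x powi (h + 1) / w x = (1 + aff x) * (1 + s x)"
      unfolding s t w_eq powi using x z0 by simp
  qed
  define t where "t = aff"
  have q: "t x ^ q = t x + 1" "s x ^ q = s x + 1" if "x \<in> U - {1}" for x
    using that ne1[OF that] aff_pow_q U_powi by (auto simp: s_def t_def)
  \<comment> \<open>The affine dependency of the three points: these weights sum to 0 and annihilate
    both coordinates.\<close>
  define g1 g2 g3 where "g1 = t x2 + t x3" and "g2 = t x3 + t x1" and "g3 = t x1 + t x2"
  have g: "g1 \<in> Fq" "g2 \<in> Fq" "g3 \<in> Fq" using x by (auto simp: g1_def g2_def g3_def t_def intro!: aff_add_Fq)
  have gs: "g1 * s x1 + g2 * s x2 + g3 * s x3 = 0"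
    using col by (simp add: g1_def g2_def g3_def t_def mult.commute)
  \<comment> \<open>\<open>D\<close> is what the three points contribute at both prescribed zeros.
    Lying in \<open>Fq\<close>, it can serve as the coefficient at position 0, which belongs to the
    point 1 and cancels it at both.\<close>
  define D where "D = g1 * (t x1 * (1 + s x1)) + g2 * (t x2 * (1 + s x2)) + g3 * (t x3 * (1 + s x3))"
  have gt: "g1 * t x1 + g2 * t x2 + g3 * t x3 = 0" and g123: "g1 + g2 + g3 = 0"
    by (simp_all add: g1_def g2_def g3_def algebra_simps)
  have "D ^ q = D"
  proof -
    have "D ^ q = g1 * ((t x1 + 1) * s x1) + g2 * ((t x2 + 1) * s x2) + g3 * ((t x3 + 1) * s x3)"
      using g x by (simp add: D_def pow_q_add power_mult_distrib q Fq_def add_ac)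
    also have "\<dots> = D + (g1 * t x1 + g2 * t x2 + g3 * t x3) + (g1 * s x1 + g2 * s x2 + g3 * s x3)"
      by (simp add: D_def algebra_simps)
    finally show ?thesis by (simp add: gs gt)
  qed
  then have "D \<in> Fq" by (simp add: Fq_def)
  have D': "D = g1 * ((1 + t x1) * (1 + s x1)) + g2 * ((1 + t x2) * (1 + s x2)) + g3 * ((1 + t x3) * (1 + s x3))"
  proof -
    have "g1 * ((1 + t x1) * (1 + s x1)) + g2 * ((1 + t x2) * (1 + s x2)) + g3 * ((1 + t x3) * (1 + s x3)) =
      D + (g1 + g2 + g3) + (g1 * s x1 + g2 * s x2 + g3 * s x3)"
      by (simp add: D_def algebra_simps)
    then show ?thesis by (simp add: gs g123)
  qed
  have gw: "g / w y * y powi h = g * (t y * (1 + s y))"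
    "g / w y * y powi (h + 1) = g * ((1 + t y) * (1 + s y))" if "y \<in> U - {1}" for g y
    unfolding t_def w(3)[OF that, symmetric] w(4)[OF that, symmetric] by simp_all
  have wx: "w x1 \<in> Fq" "w x2 \<in> Fq" "w x3 \<in> Fq" using x w(1) by auto
  obtain a1 a2 a3 a4 where a: "emb a1 = g1 / w x1" "emb a2 = g2 / w x2" "emb a3 = g3 / w x3" "emb a4 = D"
    using Fq_divide[OF g(1) wx(1)] Fq_divide[OF g(2) wx(2)] Fq_divide[OF g(3) wx(3)] \<open>D \<in> Fq\<close>
    unfolding range_emb[symmetric] by (auto simp: image_iff)
  obtain i1 i2 i3 where i: "x1 = \<beta> ^ i1" "x2 = \<beta> ^ i2" "x3 = \<beta> ^ i3" "i1 < n" "i2 < n" "i3 < n"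
    using x unfolding U_eq by blast
  then have distinct: "i1 \<noteq> 0" "i1 \<noteq> i2" "i1 \<noteq> i3" using x by (auto intro: gr0I)
  define c where "c = Polynomial.monom a1 i1 + Polynomial.monom a2 i2 + Polynomial.monom a3 i3
    + Polynomial.monom a4 0"
  have c_coeff: "poly.coeff c i = 0" if "i \<notin> {i1, i2, i3, 0}" for i
    using that by (simp add: c_def)
  have "g1 \<noteq> 0" using x by (simp add: g1_def t_def aff_eq_iff add_eq_0_b)
  then have "a1 \<noteq> 0" using a(1) w(2)[of x1] x by auto
  then have "poly.coeff c i1 \<noteq> 0" using distinct by (simp add: c_def)
  then have "c \<noteq> 0" by auto
  moreover have "c \<in> words n" using c_coeff i n_ge by (force simp: words_def)
  moreover have "evalp c (\<beta> powi j) =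
      emb a1 * x1 powi j + emb a2 * x2 powi j + emb a3 * x3 powi j + D" for j
  proof -
    have "(\<beta> powi j) ^ l = (\<beta> ^ l) powi j" for l
      by (simp add: mult.commute flip: power_int_mult power_int_of_nat)
    then show ?thesis using i a(4) by (simp add: c_def hom_distribs poly_monom)
  qed
  moreover have "emb a1 * x1 powi h + emb a2 * x2 powi h + emb a3 * x3 powi h = D"
    unfolding a D_def using x by (simp only: gw)
  moreover have "emb a1 * x1 powi (h + 1) + emb a2 * x2 powi (h + 1) + emb a3 * x3 powi (h + 1) = D"
    unfolding a D' using x by (simp only: gw)
  ultimately have "5 \<le> hamming_dist n c 0" by (intro wt) auto
  also have "\<dots> \<le> card {i1, i2, i3, 0}"
    unfolding hamming_dist_def coeff_0 using c_coeff by (intro card_mono subsetI) blast+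
  also have "\<dots> \<le> 4" by (simp add: card_insert_if)
  finally show False by simp
qed

text \<open>Scaling by an element of \<open>Fq\<close> other than 0 and 1 permutes the units but
  multiplies their sum by that element; \<open>q > 2\<close> provides one.\<close>

lemma sum_Fq_units: "(\<Sum>x\<in>Fq - {0}. x) = 0"
proof -
  have "card {0, 1 :: 'b} < card Fq" using q_ge by (simp add: card_Fq)
  then obtain a where a: "a \<in> Fq" "a \<noteq> 0" "a \<noteq> 1"
    by (metis card_mono finite insertCI linorder_not_less subsetI)
  have "(\<Sum>x\<in>Fq - {0}. x) = (\<Sum>x\<in>Fq - {0}. a * x)"
    using a by (intro sum.reindex_bij_witness[of _ "\<lambda>x. a * x" "\<lambda>x. x / a"])
      (auto intro: Fq_mult Fq_divide)
  also have "\<dots> = a * (\<Sum>x\<in>Fq - {0}. x)" by (simp add: sum_distrib_left)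
  finally show ?thesis using a by (metis mult_cancel_right1)
qed

section \<open>Fourier analysis of the affine coordinate on \<open>U\<close>\<close>

definition odds :: "nat set" where "odds = {j. j < n \<and> odd j}"

text \<open>On \<open>U - {1}\<close> the polynomial \<open>L\<close> agrees with \<open>aff\<close>, which turns the slope sums below into sums of
  characters of \<open>U\<close>.\<close>

definition L :: "'b \<Rightarrow> 'b" where "L y = (\<Sum>j\<in>odds. y ^ j)"

lemma odds_eq: "odds = (\<lambda>i. 2 * i + 1) ` {..<q div 2}"
  unfolding odds_def using even_q by (auto simp: n_eq image_iff elim!: oddE)

text \<open>Multiplying by \<open>(y + 1) * (y + 1)\<close>, which is \<open>y ^ 2 + 1\<close>,
  telescopes the geometric sum in \<open>y ^ 2\<close>; on \<open>U\<close> the top power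
  \<open>y ^ q\<close> is \<open>inverse y\<close>.\<close>

lemma L_eq_aff:
  assumes "y \<in> U" "y \<noteq> 1"
  shows "L y = aff y"
proof -
  have "(y + 1) * (y + 1) * (\<Sum>i<N. y ^ (2 * i + 1)) = y * (y ^ (2 * N) + 1)" for N
  proof (induction N)
    case (Suc N)
    have "(y + 1) * (y + 1) * y ^ (2 * N + 1) = y * (y ^ (2 * N) + y ^ (2 * Suc N))"
      by (simp add: algebra_simps)
    then show ?case using Suc by (simp add: algebra_simps)
  qed simp
  from this[of "q div 2"] have "(y + 1) * (y + 1) * L y = y * (y ^ q + 1)"
    unfolding L_def odds_eq using even_q by (subst sum.reindex) (auto simp: inj_on_def)
  also have "\<dots> = y + 1" using assms U_nonzero[OF assms(1)] by (simp add: U_pow_q algebra_simps)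
  finally have "(y + 1) * ((y + 1) * L y) = (y + 1) * 1" by (simp only: mult.assoc mult_1_right)
  moreover have "y + 1 \<noteq> 0" using assms by (simp add: add_eq_0_b)
  ultimately have "(y + 1) * L y = 1" by (simp only: mult_cancel_left) simp
  then show ?thesis unfolding aff_def by (rule inverse_unique[symmetric])
qed

text \<open>The exponents in \<open>L\<close> are positive and below \<open>n\<close>, so each
  character sums to 0.\<close>

lemma sum_L_mult: "v \<in> U \<Longrightarrow> (\<Sum>x\<in>U. L (x * v)) = 0"
proof -
  assume "v \<in> U"
  have "(\<Sum>x\<in>U. L (x * v)) = (\<Sum>j\<in>odds. v ^ j * (\<Sum>x\<in>U. x ^ j))"
    unfolding L_def power_mult_distrib by (subst sum.swap) (simp add: sum_distrib_left mult.commute)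
  also have "\<dots> = 0"
    by (rule sum.neutral) (auto simp: U_sum_power odds_def dest!: dvd_imp_le odd_pos)
  finally show ?thesis .
qed

text \<open>Orthogonality picks the frequency \<open>a mod n\<close>, which occurs in
  \<open>L\<close> exactly when it is odd. Negative frequencies are written as multiples of
  \<open>q\<close>, which is -1 modulo \<open>n\<close>.\<close>

lemma fourier_L_quotient:
  assumes x: "x \<in> U"
  shows "(\<Sum>u\<in>U. u ^ a * L (x * inverse u)) = (if odd (a mod n) then x ^ a else 0)"
proof -
  have inv: "inverse u ^ j = u ^ (q * j)" if "u \<in> U" for u j
    using that by (simp add: U_pow_q power_mult)
  have dvd: "n dvd a + q * j \<longleftrightarrow> a mod n = j" if "j < n" for j
  proof -
    have eq: "a + q * j + j = a + n * j" by (simp add: n_eq)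
    have "n dvd a + q * j \<longleftrightarrow> [a + q * j + j = 0 + j] (mod n)"
      by (simp only: cong_add_rcancel_nat cong_0_iff)
    also have "\<dots> \<longleftrightarrow> [a = j] (mod n)"
      unfolding eq by (simp add: cong_def)
    also have "\<dots> \<longleftrightarrow> a mod n = j" using that by (simp add: cong_def)
    finally show ?thesis .
  qed
  have "(\<Sum>u\<in>U. u ^ a * L (x * inverse u)) = (\<Sum>u\<in>U. \<Sum>j\<in>odds. x ^ j * u ^ (a + q * j))"
    unfolding L_def power_mult_distrib
    by (intro sum.cong refl) (simp add: inv sum_distrib_left power_add mult_ac)
  also have "\<dots> = (\<Sum>j\<in>odds. x ^ j * (\<Sum>u\<in>U. u ^ (a + q * j)))"
    by (subst sum.swap) (simp add: sum_distrib_left)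
  also have "\<dots> = (\<Sum>j\<in>odds. if a mod n = j then x ^ j else 0)"
    by (intro sum.cong refl) (auto simp: U_sum_power dvd odds_def)
  also have "\<dots> = (if odd (a mod n) then x ^ (a mod n) else 0)"
    using n_ge by (subst sum.delta') (auto simp: odds_def)
  finally show ?thesis by (simp add: pow_mod_n[OF x])
qed

text \<open>Here \<open>l\<close> stands for \<open>- a\<close>. Orthogonality selects the
  \<open>j\<close> with \<open>K * j\<close> congruent to \<open>l\<close>, that is,
  \<open>M * l mod n\<close>.\<close>

lemma fourier_L_power:
  assumes KM: "[K * M = 1] (mod n)" and l: "n dvd a + l"
  shows "(\<Sum>x\<in>U. x ^ a * L (x ^ K)) = (if odd (M * l mod n) then 1 else 0)"
proof -
  have dvd: "n dvd a + K * j \<longleftrightarrow> M * l mod n = j" if "j < n" for j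
  proof -
    have "n dvd a + K * j \<longleftrightarrow> [a + K * j = a + l] (mod n)"
      using l by (metis cong_0_iff cong_sym cong_trans)
    also have "\<dots> \<longleftrightarrow> [K * j = l] (mod n)" by (rule cong_add_lcancel_nat)
    also have "\<dots> \<longleftrightarrow> [j = M * l] (mod n)"
    proof
      assume "[K * j = l] (mod n)"
      then have "[M * (K * j) = M * l] (mod n)" by (intro cong_mult cong_refl)
      moreover have "[K * M * j = 1 * j] (mod n)" by (intro cong_mult cong_refl KM)
      ultimately show "[j = M * l] (mod n)" by (simp add: mult_ac) (metis cong_sym cong_trans)
    next
      assume "[j = M * l] (mod n)"
      then have "[K * j = K * (M * l)] (mod n)" by (intro cong_mult cong_refl)
      moreover have "[K * M * l = 1 * l] (mod n)" by (intro cong_mult cong_refl KM)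
      ultimately show "[K * j = l] (mod n)" by (simp add: mult_ac) (metis cong_trans)
    qed
    also have "\<dots> \<longleftrightarrow> M * l mod n = j" using that by (auto simp: cong_def)
    finally show ?thesis .
  qed
  have "(\<Sum>x\<in>U. x ^ a * L (x ^ K)) = (\<Sum>x\<in>U. \<Sum>j\<in>odds. x ^ (a + K * j))"
    unfolding L_def by (simp add: sum_distrib_left power_add power_mult)
  also have "\<dots> = (\<Sum>j\<in>odds. if M * l mod n = j then 1 else 0)"
    by (subst sum.swap, intro sum.cong refl) (auto simp: U_sum_power dvd odds_def)
  also have "\<dots> = (if odd (M * l mod n) then 1 else 0)"
    using n_ge by (subst sum.delta') (auto simp: odds_def)
  finally show ?thesis .
qed

text \<open>On the punctured group the slope equals \<open>T x\<close>, an expression in values of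
  \<open>L\<close> that vanishes at the removed points 1 and \<open>u\<close>. The sum thus extends
  to \<open>U\<close>, where the sums of a single \<open>L\<close> over \<open>x\<close> vanish,
  leaving an equation for \<open>Q\<close>.\<close>

lemma slope_sum_identity:
  assumes KM: "[K * M = 1] (mod n)"
    and u: "u \<in> U - {1}"
    and K1: "\<And>x. x \<in> U - {1} \<Longrightarrow> x ^ K \<noteq> 1"
    and sum: "(\<Sum>x\<in>U - {1, u}. (aff (x ^ K) + aff (u ^ K)) / (aff x + aff u)) = 0"
  shows "(1 + u ^ K) * (1 + u) * (\<Sum>x\<in>U. L (x ^ K) * L (x * inverse u)) = u"
proof -
  let ?v = "inverse u"
  define Q where "Q = (\<Sum>x\<in>U. L (x ^ K) * L (x * ?v))"
  define T where "T x = (L (x ^ K) + L (u ^ K)) * ((1 + u) * (1 + (1 + ?v) * L (x * ?v)))" for x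
  have u': "u \<in> U" "u \<noteq> 1" "u \<noteq> 0" "u + 1 \<noteq> 0" "?v \<in> U"
    using u U_nonzero U_inverse by (auto simp: add_eq_0_b)
  have uK: "u ^ K \<in> U" "u ^ K \<noteq> 1" "u ^ K + 1 \<noteq> 0"
    using u' U_power K1[OF u] by (auto simp: add_eq_0_b)
  have term_eq: "(aff (x ^ K) + aff (u ^ K)) / (aff x + aff u) = T x" if "x \<in> U - {1, u}" for x
  proof -
    have x: "x \<in> U" "x \<noteq> 1" "x \<noteq> u" "x + 1 \<noteq> 0" "x + u \<noteq> 0" using that by (auto simp: add_eq_0_b)
    have "x * ?v \<noteq> 1" using x u' by (simp add: field_simps)
    moreover have "x * ?v \<in> U" using x u' U_mult by blast
    ultimately have "L (x * ?v) = inverse (x * ?v + 1)" by (simp add: L_eq_aff aff_def)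
    also have "\<dots> = u / (x + u)" using u' by (simp add: field_simps)
    finally have Lv: "L (x * ?v) = u / (x + u)" .
    have "1 + (1 + ?v) * (u / (x + u)) = (x + 1) / (x + u)"
    proof -
      have "(1 + ?v) * u = u + 1" using u' by (simp add: distrib_right)
      then have "(1 + ?v) * (u / (x + u)) = (u + 1) / (x + u)" by (simp only: times_divide_eq_right)
      moreover have "1 + (u + 1) / (x + u) = (x + 1) / (x + u)"
        using x(5) by (simp add: divide_simps add_ac)
      ultimately show ?thesis by (simp only:)
    qed
    moreover have "aff x + aff u = (x + u) / ((x + 1) * (u + 1))"
      using u' x by (simp add: aff_def field_simps)
    moreover have "L (x ^ K) = aff (x ^ K)" "L (u ^ K) = aff (u ^ K)"
      using x K1[of x] uK by (auto intro!: L_eq_aff U_power)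
    ultimately show ?thesis by (simp add: T_def Lv add.commute mult_ac)
  qed
  have "T u = 0" by (simp add: T_def)
  moreover have "T 1 = 0"
  proof -
    have "L ?v = aff ?v" using u' by (intro L_eq_aff) auto
    also have "\<dots> = u / (u + 1)" using u' by (simp add: aff_def field_simps)
    finally have "(1 + ?v) * L ?v = 1" using u' by (simp add: field_simps)
    then show ?thesis by (simp add: T_def)
  qed
  moreover have "(\<Sum>x\<in>U - {1, u}. T x) = 0"
    using sum by (simp add: term_eq cong: sum.cong_simp)
  moreover have "(\<Sum>x\<in>U. T x) = (\<Sum>x\<in>U - {1, u}. T x) + (\<Sum>x\<in>{1, u}. T x)"
    using u' U_1 by (intro sum.subset_diff) auto
  ultimately have "(\<Sum>x\<in>U. T x) = 0" using u' by simp
  moreover have "(\<Sum>x\<in>U. T x) = (1 + u) * ((\<Sum>x\<in>U. L (x ^ K)) + L (u ^ K) * of_nat (card U)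
      + (1 + ?v) * Q + (1 + ?v) * L (u ^ K) * (\<Sum>x\<in>U. L (x * ?v)))"
    by (simp add: T_def Q_def algebra_simps sum.distrib sum_distrib_left)
  moreover have "(\<Sum>x\<in>U. L (x ^ K)) = 0" using fourier_L_power[OF KM, of 0 0] by simp
  moreover have "(\<Sum>x\<in>U. L (x * ?v)) = 0" using u' by (intro sum_L_mult)
  moreover have "(of_nat (card U) :: 'b) = 1" using odd_n by (simp add: card_U of_nat_b)
  ultimately have "(1 + u) * (L (u ^ K) + (1 + ?v) * Q) = 0" by simp
  then have "L (u ^ K) + (1 + ?v) * Q = 0" using u' by (simp add: add.commute)
  then have "(1 + ?v) * Q = inverse (u ^ K + 1)"
    using uK by (simp add: add_eq_0_b L_eq_aff aff_def)
  then have "u * (u ^ K + 1) * ((1 + ?v) * Q) = u" using uK by simp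
  moreover have "u * (u ^ K + 1) * ((1 + ?v) * Q) = (1 + u ^ K) * (1 + u) * Q"
  proof -
    have "u * (1 + ?v) = 1 + u" using u' by (simp add: field_simps)
    moreover have "u * (u ^ K + 1) * ((1 + ?v) * Q) = (1 + u ^ K) * (u * (1 + ?v)) * Q"
      by (simp only: ac_simps)
    ultimately show ?thesis by (simp only:)
  qed
  ultimately show ?thesis unfolding Q_def by (simp only:)
qed

text \<open>The Fourier coefficient of \<open>slope_sum_identity\<close> at \<open>a = n - l\<close>
  is a sum of four values 0 or 1. The parity of \<open>l\<close> leaves two of them, one governed by
  the parity of \<open>M * l mod n\<close>, the other by that of
  \<open>M * (l - 1) mod n\<close>.\<close>

lemma slope_sum_parity:
  assumes KM: "[K * M = 1] (mod n)" and K: "even K" "K < n"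
    and K1: "\<And>x. x \<in> U - {1} \<Longrightarrow> x ^ K \<noteq> 1"
    and sum: "\<And>u. u \<in> U - {1} \<Longrightarrow>
      (\<Sum>x\<in>U - {1, u}. (aff (x ^ K) + aff (u ^ K)) / (aff x + aff u)) = 0"
    and l: "2 \<le> l" "l < K"
  shows "even (M * l mod n) \<longleftrightarrow> even (M * (l - 1) mod n)"
proof -
  define Q where "Q u = (\<Sum>x\<in>U. L (x ^ K) * L (x * inverse u))" for u
  define P where "P a = (\<Sum>u\<in>U. u ^ a * Q u)" for a
  have P: "P a = (if odd (a mod n) \<and> odd (M * b mod n) then 1 else 0)" if "n dvd a + b" for a b
  proof -
    have "P a = (\<Sum>x\<in>U. L (x ^ K) * (\<Sum>u\<in>U. u ^ a * L (x * inverse u)))"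
      unfolding P_def Q_def sum_distrib_left by (subst sum.swap) (simp add: mult_ac)
    also have "\<dots> = (\<Sum>x\<in>U. if odd (a mod n) then x ^ a * L (x ^ K) else 0)"
      by (intro sum.cong refl) (simp add: fourier_L_quotient)
    also have "\<dots> = (if odd (a mod n) \<and> odd (M * b mod n) then 1 else 0)"
      using fourier_L_power[OF KM that] by (cases "odd (a mod n)") simp_all
    finally show ?thesis .
  qed
  define a where "a = n - l"
  have a: "a + l = n" using l K by (simp add: a_def)
  \<comment> \<open>The identity holds away from \<open>u = 1\<close>; there the factor
    \<open>1 + u\<close> kills the product and the expression is 1.\<close>
  have one: "(\<Sum>u\<in>U. u ^ a * ((1 + u ^ K) * (1 + u) * Q u + u)) = 1"
  proof -
    have "(\<Sum>u\<in>U. u ^ a * ((1 + u ^ K) * (1 + u) * Q u + u)) = (\<Sum>u\<in>U. if 1 = u then 1 else 0)"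
    proof (rule sum.cong[OF refl])
      fix u assume "u \<in> U"
      then show "u ^ a * ((1 + u ^ K) * (1 + u) * Q u + u) = (if 1 = u then 1 else 0)"
        using slope_sum_identity[OF KM _ K1 sum, of u] by (cases "u = 1") (auto simp: Q_def)
    qed
    also have "\<dots> = 1" using U_1 by (simp add: sum.delta')
    finally show ?thesis .
  qed
  have "(\<Sum>u\<in>U. u ^ a * ((1 + u ^ K) * (1 + u) * Q u + u)) =
      P a + P (a + 1) + P (a + K) + P (a + K + 1) + (\<Sum>u\<in>U. u ^ (a + 1))"
    unfolding P_def sum.distrib[symmetric]
    by (intro sum.cong refl) (simp add: algebra_simps power_add)
  \<comment> \<open>The bound \<open>2 \<le> l\<close> keeps \<open>a + 1\<close> below
    \<open>n\<close>.\<close>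
  moreover have "\<not> n dvd a + 1" using l a by (auto dest!: dvd_imp_le)
  then have "(\<Sum>u\<in>U. u ^ (a + 1)) = 0" by (simp only: U_sum_power if_False)
  ultimately have sumP: "P a + P (a + 1) + P (a + K) + P (a + K + 1) = 1"
    using one by (simp only: add_0_right)
  define v w where "v = M * l mod n" and "w = M * (l - 1) mod n"
  have cop: "coprime M n" using KM by (metis cong_imp_coprime cong_sym coprime_1_left coprime_mult_left_iff)
  have pos: "v > 0" "w > 0"
  proof -
    have "\<not> n dvd M * i" if "0 < i" "i < n" for i
      using cop that by (metis coprime_commute coprime_dvd_mult_right_iff dvd_imp_le linorder_not_less)
    then show "v > 0" "w > 0" using l K unfolding v_def w_def by (auto simp: mod_greater_zero_iff_not_dvd)
  qed
  \<comment> \<open>\<open>q * K\<close> represents \<open>- K\<close>, so the residue drops by 1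
    and changes parity; being positive, it does not wrap around.\<close>
  have shift: "M * (i + q * K) mod n = M * i mod n - 1" if "M * i mod n > 0" for i
  proof -
    have "[M * (i + q * K) = M * i + q * 1] (mod n)"
    proof -
      have "[M * i + q * (K * M) = M * i + q * 1] (mod n)" by (intro cong_add cong_mult cong_refl KM)
      then show ?thesis by (simp add: algebra_simps)
    qed
    also have "[M * i + q * 1 = M * i mod n + q] (mod n)" by (simp add: cong_def mod_add_left_eq)
    also have "M * i mod n + q = n + (M * i mod n - 1)" using that by (simp add: n_eq)
    finally have "M * (i + q * K) mod n = (M * i mod n - 1) mod n" by (simp add: cong_def)
    also have "\<dots> = M * i mod n - 1"
      using n_ge by (intro mod_less) (metis gr_zeroI less_imp_diff_less mod_less_divisor not_numeral_le_zero)
    finally show ?thesis .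
  qed
  have oddeven: "odd (x - 1) \<longleftrightarrow> even x" if "x > 0" for x :: nat using that by (cases x) auto
  have P0: "P a = (if even l \<and> odd v then 1 else 0)"
    using P[of a l] a l odd_n by (auto simp: a_def v_def)
  have P1: "P (a + 1) = (if odd l \<and> odd w then 1 else 0)"
  proof -
    have "a + 1 + (l - 1) = n" using a l by simp
    moreover have "a + 1 < n" using a l by simp
    moreover from this have "odd (a + 1) \<longleftrightarrow> odd l" using a odd_n by presburger
    ultimately show ?thesis using P[of "a + 1" "l - 1"] a by (simp add: w_def)
  qed
  have KK: "n dvd i + K + (j + q * K)" if "i + j = n" for i j
  proof -
    have "i + K + (j + q * K) = n * (1 + K)" unfolding that[symmetric] using n_eq that by (simp add: algebra_simps)
    then show ?thesis by simp
  qed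
  have PK: "P (a + K) = (if odd l \<and> even v then 1 else 0)"
  proof -
    have "a + K = n + (K - l)" using a l by simp
    then have "(a + K) mod n = (K - l) mod n" by (simp only: mod_add_self1)
    also have "\<dots> = K - l" using l K by simp
    finally have "(a + K) mod n = K - l" .
    moreover have "odd (K - l) \<longleftrightarrow> odd l" using K l by simp
    ultimately show ?thesis
      using P[OF KK[OF a]] shift[of l] pos(1) by (simp add: oddeven flip: v_def)
  qed
  have PK1: "P (a + K + 1) = (if even l \<and> even w then 1 else 0)"
  proof -
    have "a + K + 1 = n + (K + 1 - l)" using a l by simp
    then have "(a + K + 1) mod n = (K + 1 - l) mod n" by (simp only: mod_add_self1)
    also have "\<dots> = K + 1 - l" using l K by (intro mod_less) linarith
    finally have "(a + K + 1) mod n = K + 1 - l" .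
    moreover have "odd (K + 1 - l) \<longleftrightarrow> even l" using K l by simp
    moreover have "M * (l - 1 + q * K) mod n = w - 1"
      using shift[of "l - 1"] pos(2) by (simp only: w_def)
    moreover have "(a + 1) + (l - 1) = n" using a l by simp
    from P[OF KK[OF this]] have "P (a + K + 1) =
      (if odd ((a + K + 1) mod n) \<and> odd (M * (l - 1 + q * K) mod n) then 1 else 0)"
      by (simp only: add.assoc add.commute[of 1])
    ultimately show ?thesis using oddeven[OF pos(2)] by (simp only:)
  qed
  show ?thesis
    using sumP unfolding P0 P1 PK PK1 v_def[symmetric] w_def[symmetric]
    by (cases "even l"; cases "even v"; cases "even w") simp_all
qed

section \<open>Injective slopes: their sum, and the exponents \<open>2 ^ e\<close>\<close>

lemma card_punctured: "u \<in> U - {1} \<Longrightarrow> card (U - {1, u}) = q - 1"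
proof -
  assume "u \<in> U - {1}"
  then have "card (U - {1, u}) = n - 2" using U_1 by (subst card_Diff_subset) (auto simp: card_U)
  also have "\<dots> = q - 1" by (simp add: n_eq)
  finally show ?thesis .
qed

text \<open>The slopes are nonzero elements of \<open>Fq\<close>. Being distinct and
  \<open>q - 1\<close> in number, they are all the units, whose sum is 0.\<close>

lemma slope_sum_zero:
  assumes u: "u \<in> U - {1}"
    and K1: "\<And>x. x \<in> U - {1} \<Longrightarrow> x ^ K \<noteq> 1"
    and Kinj: "inj_on (\<lambda>x. x ^ K) U"
    and inj: "inj_on (\<lambda>x. (aff (x ^ K) + aff (u ^ K)) / (aff x + aff u)) (U - {1, u})"
  shows "(\<Sum>x\<in>U - {1, u}. (aff (x ^ K) + aff (u ^ K)) / (aff x + aff u)) = 0"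
proof -
  let ?s = "\<lambda>x. (aff (x ^ K) + aff (u ^ K)) / (aff x + aff u)"
  have "?s ` (U - {1, u}) \<subseteq> Fq - {0}"
  proof
    fix y assume "y \<in> ?s ` (U - {1, u})"
    then obtain x where x: "x \<in> U" "x \<noteq> 1" "x \<noteq> u" and y: "y = ?s x" by auto
    have "x ^ K \<noteq> u ^ K" using Kinj x u by (auto dest: inj_onD)
    then have "y \<noteq> 0" using x by (simp add: y add_eq_0_b aff_eq_iff)
    moreover have "y \<in> Fq" unfolding y
      using x u K1[of x] K1[of u] by (intro Fq_divide aff_add_Fq U_power) auto
    ultimately show "y \<in> Fq - {0}" by simp
  qed
  moreover have "card (Fq - {0}) \<le> card (?s ` (U - {1, u}))"
    using card_punctured[OF u] Fq_0 by (simp add: card_image[OF inj] card_Fq)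
  ultimately have "?s ` (U - {1, u}) = Fq - {0}" by (intro card_seteq) auto
  then have "(\<Sum>x\<in>U - {1, u}. ?s x) = (\<Sum>y\<in>Fq - {0}. y)"
    using sum.reindex[OF inj, of "\<lambda>y. y"] by simp
  then show ?thesis by (simp add: sum_Fq_units)
qed

text \<open>If \<open>d = gcd e m\<close> is not 1, then \<open>N = 2 ^ d - 1\<close> divides both
  \<open>2 ^ e - 1\<close> and \<open>q - 1\<close>, so the \<open>N\<close>-th power map is
  injective, hence onto, on the units of \<open>Fq\<close>. All \<open>q - 1\<close> units are then
  roots of unity of order dividing \<open>(q - 1) / N\<close>, too many as \<open>N \<ge> 3\<close>.
  The case \<open>e = 0\<close> is covered with \<open>d = m\<close>.\<close>

lemma slope_injective_imp_coprime:
  assumes inj: "inj_on (\<lambda>a. a ^ (2 ^ e - 1)) (Fq - {0})"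
  shows "coprime e m"
proof (rule ccontr)
  assume "\<not> coprime e m"
  define d where "d = gcd e m"
  have d: "d \<noteq> 1" "d dvd e" "d dvd m" "d \<noteq> 0"
    using \<open>\<not> coprime e m\<close> m_ge by (auto simp: d_def coprime_iff_gcd_eq_1)
  define N where "N = (2::nat) ^ d - 1"
  have "(2::nat) ^ 2 \<le> 2 ^ d" using d by (intro power_increasing) auto
  then have N: "N \<ge> 3" by (simp add: N_def)
  obtain k where k: "2 ^ e - 1 = N * k" using two_power_minus_one_dvd[OF d(2)] by (auto simp: N_def)
  obtain r where r: "q - 1 = N * r" using two_power_minus_one_dvd[OF d(3)] by (auto simp: N_def q_eq)
  have "inj_on (\<lambda>a. a ^ N) (Fq - {0})"
    by (rule inj_onI) (metis inj inj_onD k power_mult)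
  moreover have "(\<lambda>a. a ^ N) ` (Fq - {0}) \<subseteq> Fq - {0}" by (auto intro: Fq_power)
  ultimately have surj: "(\<lambda>a. a ^ N) ` (Fq - {0}) = Fq - {0}" by (simp add: endo_inj_surj)
  have "a ^ (q - 1) = 1" if "a \<in> Fq - {0}" for a
  proof -
    have "a ^ (q - 1) * a = a ^ q" using q_ge by (intro power_minus_mult) simp
    also have "\<dots> = 1 * a" using that by (simp add: Fq_def)
    finally show ?thesis using that by (simp only: mult_right_cancel Diff_iff singleton_iff) simp
  qed
  note power_q = this
  have r0: "r > 0" using r q_ge by (intro gr0I) auto
  then have "poly.coeff (Polynomial.monom 1 r - 1 :: 'b poly) r = 1" by simp
  then have p0: "(Polynomial.monom 1 r - 1 :: 'b poly) \<noteq> 0" by (metis coeff_0 zero_neq_one)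
  have "b ^ r = 1" if b: "b \<in> Fq - {0}" for b
  proof -
    obtain a where "a \<in> Fq - {0}" "b = a ^ N" using b surj by blast
    then show ?thesis using power_q[of a] r by (simp flip: power_mult)
  qed
  then have "Fq - {0} \<subseteq> {x. poly (Polynomial.monom 1 r - 1) x = 0}" by (auto simp: poly_monom)
  then have "card (Fq - {0}) \<le> card {x :: 'b. poly (Polynomial.monom 1 r - 1) x = 0}"
    by (intro card_mono) auto
  also have "card {x :: 'b. poly (Polynomial.monom 1 r - 1) x = 0} \<le> degree (Polynomial.monom 1 r - 1 :: 'b poly)"
    by (rule card_poly_roots_bound[OF p0])
  also have "\<dots> \<le> r" by (intro degree_diff_le) (auto simp: degree_monom_eq)
  finally have "q - 1 \<le> r" using Fq_0 by (simp add: card_Fq)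
  moreover have "3 * r \<le> q - 1" using N r by simp
  ultimately show False using r0 by linarith
qed

lemma aff_frobenius: "aff (x ^ 2 ^ e) = aff x ^ 2 ^ e"
  by (simp add: aff_def frobenius power_inverse)

lemma aff_add_surj:
  assumes u: "u \<in> U - {1}" and a: "a \<in> Fq - {0}"
  obtains x where "x \<in> U - {1, u}" "aff x + aff u = a"
proof -
  let ?f = "\<lambda>x. aff x + aff u"
  have inj: "inj_on ?f (U - {1, u})" by (rule inj_onI) (simp add: aff_eq_iff)
  have "?f ` (U - {1, u}) \<subseteq> Fq - {0}"
    using u by (auto simp: add_eq_0_b aff_eq_iff intro: aff_add_Fq)
  moreover have "card (Fq - {0}) \<le> card (?f ` (U - {1, u}))"
    using card_punctured[OF u] Fq_0 by (simp add: card_image[OF inj] card_Fq)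
  ultimately have "?f ` (U - {1, u}) = Fq - {0}" by (intro card_seteq) auto
  then have "a \<in> ?f ` (U - {1, u})" using a by (simp only:)
  then obtain x where "a = ?f x" "x \<in> U - {1, u}" by (rule imageE)
  then show ?thesis using that by simp
qed

lemma weight_ge_5_imp_power_of_two:
  assumes wt: "\<And>c. c \<in> words n \<Longrightarrow> c \<noteq> 0 \<Longrightarrow> evalp c (\<beta> powi h) = 0 \<Longrightarrow>
      evalp c (\<beta> powi (h + 1)) = 0 \<Longrightarrow> 5 \<le> hamming_dist n c 0"
    and K: "even K" "0 < K" "K < n" "coprime K n"
    and hK: "[2 * h + 1 = int K] (mod int n) \<or> [2 * h + 1 = - int K] (mod int n)"
  shows "\<exists>e. coprime e m \<and> K = 2 ^ e"
proof -
  obtain M0 where "[K * M0 = 1] (mod n)" using cong_solve_coprime_nat[OF K(4)] by auto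
  then have KM: "[K * (M0 mod n) = 1] (mod n)" by (simp add: cong_def mod_mult_right_eq)
  define M where "M = M0 mod n"
  have M: "[K * M = 1] (mod n)" "M < n" using KM n_ge by (auto simp: M_def)
  have Kinj: "inj_on (\<lambda>x. x ^ K) U"
  proof (rule inj_onI)
    fix x y assume xy: "x \<in> U" "y \<in> U" "x ^ K = y ^ K"
    have "x ^ (K * M) = y ^ (K * M)" using xy(3) by (simp add: power_mult)
    then show "x = y" using xy U_pow_cong[OF _ M(1)] by simp
  qed
  have K1: "x ^ K \<noteq> 1" if "x \<in> U - {1}" for x
    using that inj_onD[OF Kinj, of x 1] U_1 by auto
  have powi_K: "(\<forall>x\<in>U. x powi (2 * h + 1) = x ^ K) \<or> (\<forall>x\<in>U. x powi (2 * h + 1) = inverse (x ^ K))"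
    using hK U_powi_cong by (fastforce simp: power_int_minus)
  have ne1: "x powi (2 * h + 1) \<noteq> 1" if "x \<in> U - {1}" for x
    using powi_K K1[OF that] that by auto
  \<comment> \<open>If the power is inverted, both values of \<open>aff\<close> shift by 1 and the
    shifts cancel.\<close>
  have s_add: "aff (x powi (2 * h + 1)) + aff (y powi (2 * h + 1)) = aff (x ^ K) + aff (y ^ K)"
    if "x \<in> U - {1}" "y \<in> U - {1}" for x y
  proof -
    have "aff (inverse (z ^ K)) = aff (z ^ K) + 1" if "z \<in> U - {1}" for z
      using that K1[OF that] U_nonzero by (intro aff_inverse) auto
    then show ?thesis using powi_K that by (auto simp: add_ac)
  qed
  have inj: "inj_on (\<lambda>x. (aff (x ^ K) + aff (u ^ K)) / (aff x + aff u)) (U - {1, u})"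
    if u: "u \<in> U - {1}" for u
  proof (rule inj_onI, rule ccontr)
    fix x y assume xy: "x \<in> U - {1, u}" "y \<in> U - {1, u}" "x \<noteq> y"
      and eq: "(aff (x ^ K) + aff (u ^ K)) / (aff x + aff u) = (aff (y ^ K) + aff (u ^ K)) / (aff y + aff u)"
    have "aff x + aff u \<noteq> 0" "aff y + aff u \<noteq> 0" using xy by (auto simp: add_eq_0_b aff_eq_iff)
    then have "(aff (u ^ K) + aff (x ^ K)) * (aff u + aff y) = (aff (u ^ K) + aff (y ^ K)) * (aff u + aff x)"
      using eq by (simp add: frac_eq_eq add.commute)
    moreover have "(aff (u ^ K) + aff (x ^ K)) * (aff u + aff y) \<noteq> (aff (u ^ K) + aff (y ^ K)) * (aff u + aff x)"
    proof -
      have xy': "x \<in> U - {1}" "y \<in> U - {1}" using xy by auto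
      have "(aff (u powi (2 * h + 1)) + aff (x powi (2 * h + 1))) * (aff u + aff y) \<noteq>
        (aff (u powi (2 * h + 1)) + aff (y powi (2 * h + 1))) * (aff u + aff x)"
        by (rule slopes_distinct[OF wt u xy']) (use xy ne1 in auto)
      then show ?thesis unfolding s_add[OF u xy'(1)] s_add[OF u xy'(2)] .
    qed
    ultimately show False by contradiction
  qed
  have "\<exists>e. K = 2 ^ e"
  proof (rule residue_parity_imp_power_of_two[of n m K M])
    show "even (M * l mod n) \<longleftrightarrow> even (M * (l - 1) mod n)" if "2 \<le> l" "l < K" for l
      by (rule slope_sum_parity[OF M(1) K(1,3) K1 slope_sum_zero[OF _ K1 Kinj inj] that])
  qed (use K M m_ge n_eq q_eq in \<open>auto elim!: evenE\<close>)
  then obtain e where e: "K = 2 ^ e" by blast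
  \<comment> \<open>As Frobenius is additive, the slope of the chord from \<open>\<beta>\<close> to
    \<open>x\<close> is \<open>a ^ (2 ^ e - 1)\<close> with \<open>a = aff x + aff \<beta>\<close>,
    and every unit \<open>a\<close> of \<open>Fq\<close> occurs.\<close>
  have "inj_on (\<lambda>a. a ^ (2 ^ e - 1)) (Fq - {0})"
  proof (rule inj_onI)
    fix a b assume ab: "a \<in> Fq - {0}" "b \<in> Fq - {0}" "a ^ (2 ^ e - 1) = b ^ (2 ^ e - 1)"
    have u: "\<beta> \<in> U - {1}" using beta_U beta_pow_eq_1[of 1] n_ge by auto
    obtain x y where x: "x \<in> U - {1, \<beta>}" "aff x + aff \<beta> = a" and y: "y \<in> U - {1, \<beta>}" "aff y + aff \<beta> = b"
      using aff_add_surj[OF u] ab by metis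
    have pow: "z ^ 2 ^ e / z = z ^ (2 ^ e - 1)" if "z \<noteq> 0" for z :: 'b
      using that by (simp add: power_diff)
    have "(aff (x ^ K) + aff (\<beta> ^ K)) / (aff x + aff \<beta>) = (aff (y ^ K) + aff (\<beta> ^ K)) / (aff y + aff \<beta>)"
      using ab pow[of a] pow[of b] by (simp add: e aff_frobenius x y flip: frobenius)
    then have "x = y" using inj_onD[OF inj[OF u]] x(1) y(1) by blast
    then show "a = b" using x y by simp
  qed
  then show ?thesis using slope_injective_imp_coprime e by blast
qed

section \<open>Integer exponents of two modulo \<open>n\<close>\<close>

lemma powi_mod_two_cases:
  assumes "gcd e (int m) = 1"
  shows "\<exists>e'. coprime e' m \<and>
    ([powi_mod (int n) 2 e = 2 ^ e'] (mod int n) \<or> [powi_mod (int n) 2 e = - (2 ^ e')] (mod int n))"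
proof (cases "e \<ge> 0")
  case True
  then have "coprime (int (nat e)) (int m)" using assms by (simp add: coprime_iff_gcd_eq_1)
  then have "coprime (nat e) m" by (simp only: coprime_int_iff)
  then show ?thesis using True by (intro exI[of _ "nat e"]) (simp add: powi_mod_def)
next
  case False
  define k where "k = nat (- e)"
  define i where "i = modular_inverse (int n) 2"
  have "coprime (int k) (int m)" using assms False by (simp add: k_def coprime_iff_gcd_eq_1)
  then have "coprime k m" by (simp only: coprime_int_iff)
  \<comment> \<open>Since \<open>2 ^ m\<close> is -1 modulo \<open>n\<close>, the inverse of 2 is
    \<open>- (2 ^ (m - 1))\<close>. Its \<open>k\<close>-th power is
    \<open>2 ^ ((m - 1) * k)\<close> up to sign, and this exponent stays coprime to
    \<open>m\<close>.\<close>
  then have cop: "coprime ((m - 1) * k) m"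
    using m_ge coprime_diff_one_left_nat[of m] by (simp only: coprime_mult_left_iff)
  have inv: "[2 * i = 1] (mod int n)"
    unfolding i_def using odd_n by (intro cong_modular_inverse1) simp
  have "2 * (2::int) ^ (m - 1) = int n - 1"
    using m_ge by (simp add: n_eq q_eq flip: power_Suc)
  then have "[i * (2 * - (2 ^ (m - 1))) = i * 1] (mod int n)"
    by (intro cong_mult cong_refl) (simp add: cong_iff_dvd_diff)
  moreover have "[2 * i * - (2 ^ (m - 1)) = 1 * - (2 ^ (m - 1))] (mod int n)"
    by (intro cong_mult cong_refl inv)
  ultimately have "[i = - (2 ^ (m - 1))] (mod int n)"
    by (simp add: mult_ac) (metis cong_sym cong_trans)
  then have "[i ^ k = (- (2 ^ (m - 1))) ^ k] (mod int n)" by (rule cong_pow)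
  moreover have "(- (2 ^ (m - 1))) ^ k = (if even k then 1 else - 1) * (2::int) ^ ((m - 1) * k)"
    by (simp add: power_minus' power_mult)
  ultimately show ?thesis
    using False cop by (intro exI[of _ "(m - 1) * k"]) (auto simp: powi_mod_def i_def k_def split: if_splits)
qed

end

theorem theorem4p4:
  fixes m q n :: nat and h :: int
    and emb :: "'a::{field_gcd,finite} \<Rightarrow> 'b::{field,finite}" and \<beta> :: 'b
  assumes "m \<ge> 3" and "q = 2 ^ m" and "n = q + 1"
    and "CARD('a) = q" and "CARD('b) = q ^ 2" and "field_hom emb"
    and "primitive_root_of_unity n \<beta>"
    and "0 \<le> h" and "h \<le> int q" and "h \<notin> {0, int q div 2, int q}"
    and "gcd (2 * h + 1) (int n) = 1"
  shows "MDS_code n (BCH_code_3 emb \<beta> n h) \<longleftrightarrow>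
    (\<exists>e::int. gcd e (int m) = 1 \<and>
       ([2 * h + 1 = powi_mod (int n) 2 e] (mod int n) \<or>
        [2 * h + 1 = - powi_mod (int n) 2 e] (mod int n)))"
proof -
  interpret norm_one_group m q n emb \<beta> by (rule norm_one_group.intro) fact+
  have h: "0 < h" "h < int q" using assms by auto
  have n_int: "int n = int q + 1" by (simp add: n_eq)
  have ndvd: "\<not> int n dvd h" "\<not> int n dvd h + 1"
    using h n_int by (auto dest!: zdvd_imp_le)
  have ndvd2: "\<not> int n dvd 2 * h + 1"
  proof
    assume "int n dvd 2 * h + 1"
    then have "gcd (2 * h + 1) (int n) = int n" by simp
    then show False using assms(11) n_ge by simp
  qed
  show ?thesis unfolding MDS_iff[OF ndvd ndvd2]
  proof
    assume wt: "\<forall>c\<in>words n. c \<noteq> 0 \<longrightarrow> evalp c (\<beta> powi h) = 0 \<longrightarrow> evalp c (\<beta> powi (h + 1)) = 0 \<longrightarrow>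
       5 \<le> hamming_dist n c 0"
    \<comment> \<open>Both numbers are odd, so \<open>K\<close> is even; \<open>0 < h < q\<close>
      puts it below \<open>n\<close>. Up to sign it is congruent to
      \<open>2 * h + 1\<close>.\<close>
    define K where "K = nat \<bar>int n - (2 * h + 1)\<bar>"
    have "2 * h + 1 \<noteq> int n" using ndvd2 by auto
    then have K: "even K" "0 < K" "K < n"
      using h n_int even_q by (auto simp: K_def even_nat_iff)
    have int_K: "int K = \<bar>int n - (2 * h + 1)\<bar>" by (simp add: K_def)
    have hK: "[2 * h + 1 = int K] (mod int n) \<or> [2 * h + 1 = - int K] (mod int n)"
      unfolding int_K by (auto simp: cong_iff_dvd_diff abs_if)
    have "coprime (2 * h + 1) (int n)" using assms(11) by (simp add: coprime_iff_gcd_eq_1)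
    then have "coprime (int K) (int n)"
      using hK by (metis cong_imp_coprime coprime_minus_left_iff)
    then have "coprime K n" by simp
    then obtain e where e: "coprime e m" "K = 2 ^ e"
      using weight_ge_5_imp_power_of_two[of h K] wt K hK by blast
    then have "gcd (int e) (int m) = 1" by simp
    moreover have "powi_mod (int n) 2 (int e) = int K" by (simp add: powi_mod_def e)
    ultimately show "\<exists>e::int. gcd e (int m) = 1 \<and>
       ([2 * h + 1 = powi_mod (int n) 2 e] (mod int n) \<or>
        [2 * h + 1 = - powi_mod (int n) 2 e] (mod int n))" using hK by metis
  next
    assume "\<exists>e::int. gcd e (int m) = 1 \<and>
       ([2 * h + 1 = powi_mod (int n) 2 e] (mod int n) \<or>
        [2 * h + 1 = - powi_mod (int n) 2 e] (mod int n))"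
    then obtain e where e: "gcd e (int m) = 1" "[2 * h + 1 = powi_mod (int n) 2 e] (mod int n) \<or>
        [2 * h + 1 = - powi_mod (int n) 2 e] (mod int n)" by (elim exE conjE)
    obtain e' where e': "coprime e' m" "[powi_mod (int n) 2 e = 2 ^ e'] (mod int n) \<or>
        [powi_mod (int n) 2 e = - (2 ^ e')] (mod int n)" using powi_mod_two_cases[OF e(1)] by (elim exE conjE)
    have "[2 * h + 1 = 2 ^ e'] (mod int n) \<or> [2 * h + 1 = - (2 ^ e')] (mod int n)"
      using e(2)
    proof
      assume "[2 * h + 1 = powi_mod (int n) 2 e] (mod int n)"
      then show ?thesis using e'(2) cong_trans by blast
    next
      assume *: "[2 * h + 1 = - powi_mod (int n) 2 e] (mod int n)"
      have "[- powi_mod (int n) 2 e = - (2 ^ e')] (mod int n) \<or>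
        [- powi_mod (int n) 2 e = - (- (2 ^ e'))] (mod int n)"
        using e'(2) by (simp only: cong_minus_minus_iff)
      then show ?thesis using cong_trans[OF *] unfolding minus_minus by blast
    qed
    then show "\<forall>c\<in>words n. c \<noteq> 0 \<longrightarrow> evalp c (\<beta> powi h) = 0 \<longrightarrow> evalp c (\<beta> powi (h + 1)) = 0 \<longrightarrow>
       5 \<le> hamming_dist n c 0"
      using weight_ge_5[OF e'(1)] by blast
  qed
qed

end
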